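(* Let $n\ge 2$. (i) Let $r>0$ and $D>2r$. The unique (up to isometries of $\mathbb{R}^n$) minimizer of the volume $|K|$ among all convex bodies $K\subset\mathbb{R}^n$ with inradius $r(K)=r$ and diameter $D(K)=D$ is the convex hull of a ball of radius $r$ and of two points at distance $D$ from each other whose midpoint is the center of the ball. (ii) In other words, any convex body in $\mathbb{R}^n$ with volume $V$, diameter $D$ and inradius $r$ satisfies $$V\geq 2\omega_{n-1} r^n \int_{\arccos(2r/D)}^{\pi/2} \sin^n t\, dt+\frac{\omega_{n-1} r^{n-1}}{nD^n}\left(D^2-4r^2\right)^{(n+1)/2},$$ where $\omega_{n-1}$ is the volume of the unit ball in dimension $n-1$. (iii) In particular, any convex body in $\mathbb{R}^2$ with area $A$, diameter $D$ and inradius $r$ satisfies $$A\geq r\sqrt{D^2-4r^2}+r^2\left(\pi-2\arccos\left(\frac{2r}{D}\right)\right).$$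
   Context: A convex body in $\mathbb{R}^n$ is a compact convex set with non-empty interior. $|K|$ denotes the volume (Lebesgue measure), $D(K)$ the diameter and $r(K)$ the inradius (the radius of the largest ball contained in $K$). *)

theory Defs
  imports "HOL-Analysis.Analysis"
begin

definition convex_body :: "'a::euclidean_space set \<Rightarrow> bool" where
  "convex_body K \<longleftrightarrow> compact K \<and> convex K \<and> interior K \<noteq> {}"

text \<open>For a convex body the supremum is attained (by compactness), so it is the radius of a largest
  ball contained in \<open>K\<close>.\<close>

definition inradius :: "'a::euclidean_space set \<Rightarrow> real" where
  "inradius K = Sup {\<rho>. 0 \<le> \<rho> \<and> (\<exists>x. cball x \<rho> \<subseteq> K)}"

definition isometry :: "('a::metric_space \<Rightarrow> 'a) \<Rightarrow> bool" where
  "isometry f \<longleftrightarrow> surj f \<and> (\<forall>x y. dist (f x) (f y) = dist x y)"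

definition ball_two_points_hull :: "real \<Rightarrow> 'a::euclidean_space \<Rightarrow> 'a \<Rightarrow> 'a set" where
  "ball_two_points_hull r p q = convex hull (cball (midpoint p q) r \<union> {p, q})"

definition volume_minimizer :: "real \<Rightarrow> real \<Rightarrow> 'a::euclidean_space set \<Rightarrow> bool" where
  "volume_minimizer r D =
     is_arg_min (measure lebesgue) (\<lambda>K. convex_body K \<and> inradius K = r \<and> diameter K = D)"

end

theory Submission
  imports Defs
begin

text \<open>A convex body \<open>K\<close> with inradius \<open>r\<close> and diameter \<open>D\<close> contains a ball \<open>cball c r\<close> and two points \<open>p\<close>, \<open>q\<close> at
distance \<open>D\<close>, hence the hull \<open>cap_body r c p q\<close> of all three.  Everything reduces to comparing the
volumes of these hulls for different positions of the centre \<open>c\<close>: the smallest one should be that of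
the midpoint \<open>m\<close> of \<open>p\<close> and \<open>q\<close>.

Write \<open>c = m + w\<close>.  The point reflection in \<open>m\<close> exchanges \<open>p\<close> and \<open>q\<close>, so the bodies \<open>A\<close> and \<open>B\<close> with
centres \<open>m + w\<close> and \<open>m - w\<close> have the same volume.  On every line parallel to \<open>w\<close> replace the two
chords of \<open>A\<close> and \<open>B\<close> by their Minkowski mean, the interval of the midpoints.  By Fubini the resulting
convex set \<open>M\<close>, the \<open>fibre_average\<close>, has at most the volume of \<open>A\<close> (\<open>measure_fibre_average_le\<close>).
It contains \<open>p\<close>, \<open>q\<close> and \<open>cball m r\<close>, because each point of this ball is the midpoint of its translates
by \<open>w\<close> and \<open>- w\<close>.  So the hull with centre \<open>m\<close> lies in \<open>M\<close>, and its volume is at most that of \<open>A\<close>.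

For the uniqueness let \<open>2 * r < D\<close> and \<open>w \<noteq> 0\<close>.  Some hyperplane touching \<open>cball m r\<close> passes through \<open>p\<close> or
\<open>q\<close> and has a normal \<open>\<theta>\<close> with \<open>\<theta> \<bullet> w > 0\<close>.  Its point of contact, moved by \<open>- w\<close>, is interior
to \<open>B\<close>, since there it lies strictly below the apex in direction \<open>\<theta>\<close>.  Its chord in \<open>B\<close> therefore
extends further in direction \<open>w\<close>, and \<open>M\<close> crosses the hyperplane, which supports the hull with centre \<open>m\<close>.
So the inclusion is proper, and between convex bodies a proper inclusion is a strict inequality
of volumes (\<open>measure_cap_body_ge\<close>).  The same principle shows that a minimizer equals the hull
that it contains, and all hulls centred at the midpoint with the same \<open>r\<close> and \<open>D\<close> are congruent.

The explicit bound is the volume of the optimal hull computed in slices orthogonal to \<open>q - p\<close>: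
these slices are balls of dimension \<open>n - 1\<close>, whose radius follows the sphere up to the circle where the
tangent cones from \<open>p\<close> and \<open>q\<close> touch it, and then decreases linearly.  In the plane the integral is
elementary.\<close>

section \<open>Invariance of Lebesgue measure and integration along lines\<close>
lemma emeasure_lborel_translation:
  fixes A :: "'a::euclidean_space set"
  assumes "A \<in> sets borel"
  shows "emeasure lborel {y. x + y \<in> A} = emeasure lborel A"
proof -
  have "emeasure lborel A = emeasure (distr lborel borel ((+) x)) A"
    using lborel_affine[of 1 x] by (simp add: density_1)
  also have "\<dots> = emeasure lborel {y. x + y \<in> A}"
    using assms by (subst emeasure_distr) (auto simp: vimage_def)
  finally show ?thesis ..
qed

text \<open>The image of Lebesgue measure under an orthogonal map is invariant under translations.
For two measures \<open>\<mu>\<close> and \<open>\<lambda>\<close> invariant under translations and a symmetric set \<open>C\<close>, exchanging the order of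
integration gives \<open>\<mu> C * \<lambda> B = \<lambda> C * \<mu> B\<close>; for \<open>C\<close> the unit ball, which orthogonal maps
preserve, this is \<open>\<lambda> B = \<mu> B\<close>.\<close>
lemma emeasure_orthogonal_vimage:
  fixes f :: "'a::euclidean_space \<Rightarrow> 'a"
  assumes f: "orthogonal_transformation f" and B: "B \<in> sets borel"
  shows "emeasure lborel (f -` B) = emeasure lborel B"
proof -
  have lin: "linear f" using f by (simp add: orthogonal_transformation_linear)
  have [measurable]: "f \<in> borel_measurable borel"
    using lin by (intro borel_measurable_continuous_onI linear_continuous_on)
      (simp add: linear_conv_bounded_linear)
  define \<mu> where "\<mu> = distr lborel borel f"
  have \<mu>: "emeasure \<mu> A = emeasure lborel (f -` A)" if "A \<in> sets borel" for A
    using that unfolding \<mu>_def by (subst emeasure_distr) auto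
  have [measurable_cong, simp]: "sets \<mu> = sets borel" and space\<mu>[simp]: "space \<mu> = UNIV"
    by (auto simp: \<mu>_def)
  have vim_ball: "f -` cball 0 r = cball 0 r" for r
    using f by (auto simp: orthogonal_transformation)
  have fin: "emeasure \<mu> (cball 0 r) < \<infinity>" for r
    unfolding \<mu>[OF borel_closed[OF closed_cball]] vim_ball by (rule emeasure_lborel_cball_finite)
  interpret \<mu>: sigma_finite_measure \<mu>
  proof
    show "\<exists>A. countable A \<and> A \<subseteq> sets \<mu> \<and> \<Union> A = space \<mu> \<and> (\<forall>a\<in>A. emeasure \<mu> a \<noteq> \<infinity>)"
    proof (intro exI conjI)
      show "countable (range (\<lambda>n::nat. cball 0 (real n) :: 'a set))" by auto
      show "\<Union> (range (\<lambda>n::nat. cball 0 (real n) :: 'a set)) = space \<mu>"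
        by (auto simp: real_arch_simple)
    qed (use fin in \<open>auto simp: less_top[symmetric]\<close>)
  qed
  interpret P: pair_sigma_finite \<mu> "lborel :: 'a measure" ..
  have trans: "emeasure \<mu> {y. x + y \<in> A} = emeasure \<mu> A" if A: "A \<in> sets borel" for A x
  proof -
    obtain x' where x': "f x' = x"
      using orthogonal_transformation_surj[OF f] by (metis surjD)
    have m: "{y. x + y \<in> A} \<in> sets borel" using A by measurable
    have "emeasure \<mu> {y. x + y \<in> A} = emeasure lborel {y. x' + y \<in> f -` A}"
      by (subst \<mu>[OF m]) (auto simp: linear_add[OF lin] x' vimage_def)
    also have "\<dots> = emeasure lborel (f -` A)"
      using measurable_sets_borel[of f borel A] A by (intro emeasure_lborel_translation) auto
    finally show ?thesis by (simp add: \<mu>[OF A])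
  qed
  let ?C = "cball 0 1 :: 'a set"
  have "emeasure \<mu> ?C * emeasure lborel B = (\<integral>\<^sup>+x. indicator ?C x * emeasure lborel B \<partial>\<mu>)"
  proof -
    have "(indicator ?C :: 'a \<Rightarrow> ennreal) \<in> borel_measurable \<mu>"
      by (intro borel_measurable_indicator) simp
    then show ?thesis by (simp add: nn_integral_multc)
  qed
  \<comment> \<open>the second factor may be translated by \<open>x\<close>, which couples the two variables\<close>
  also have "\<dots> = (\<integral>\<^sup>+x. (\<integral>\<^sup>+y. indicator ?C x * indicator {y. x + y \<in> B} y \<partial>lborel) \<partial>\<mu>)"
    using B by (intro nn_integral_cong, subst nn_integral_cmult)
      (auto simp: emeasure_lborel_translation)
  also have "\<dots> = (\<integral>\<^sup>+y. (\<integral>\<^sup>+x. indicator ?C x * indicator B (x + y) \<partial>\<mu>) \<partial>lborel)"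
    using B by (subst P.Fubini') (auto simp: indicator_def)
  \<comment> \<open>the inner integral is translated by \<open>- y\<close>, using the invariance of \<open>\<mu>\<close>\<close>
  also have "\<dots> = (\<integral>\<^sup>+y. (\<integral>\<^sup>+x. indicator ?C (x - y) * indicator B x \<partial>\<mu>) \<partial>lborel)"
  proof (rule nn_integral_cong)
    fix y :: 'a
    have "(\<integral>\<^sup>+x. indicator ?C x * indicator B (x + y) \<partial>\<mu>) =
          (\<integral>\<^sup>+x. indicator {x. y + x \<in> (cball y 1 \<inter> B)} x \<partial>\<mu>)"
      by (intro nn_integral_cong) (auto simp: indicator_def dist_norm algebra_simps)
    also have "\<dots> = emeasure \<mu> {x. y + x \<in> (cball y 1 \<inter> B)}"
      using B by (subst nn_integral_indicator) auto
    also have "\<dots> = emeasure \<mu> (cball y 1 \<inter> B)"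
      using B by (intro trans) auto
    also have "\<dots> = (\<integral>\<^sup>+x. indicator (cball y 1 \<inter> B) x \<partial>\<mu>)"
      using B by (subst nn_integral_indicator) auto
    also have "\<dots> = (\<integral>\<^sup>+x. indicator ?C (x - y) * indicator B x \<partial>\<mu>)"
      by (intro nn_integral_cong) (auto simp: indicator_def dist_norm norm_minus_commute)
    finally show "(\<integral>\<^sup>+x. indicator ?C x * indicator B (x + y) \<partial>\<mu>) =
        (\<integral>\<^sup>+x. indicator ?C (x - y) * indicator B x \<partial>\<mu>)" .
  qed
  also have "\<dots> = (\<integral>\<^sup>+x. (\<integral>\<^sup>+y. indicator ?C (x - y) * indicator B x \<partial>lborel) \<partial>\<mu>)"
  proof (rule P.Fubini')
    have [measurable]: "(indicator ?C :: 'a \<Rightarrow> ennreal) \<in> borel_measurable borel"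
      "(indicator B :: 'a \<Rightarrow> ennreal) \<in> borel_measurable borel"
      using B by (auto intro!: borel_measurable_indicator)
    show "(\<lambda>(x, y). indicator ?C (x - y) * indicator B x :: ennreal) \<in> borel_measurable (\<mu> \<Otimes>\<^sub>M lborel)"
      unfolding split_beta' by measurable
  qed
  \<comment> \<open>here the symmetry of the ball \<open>C\<close> enters\<close>
  also have "\<dots> = (\<integral>\<^sup>+x. (\<integral>\<^sup>+y. indicator {y. -x + y \<in> ?C} y * indicator B x \<partial>lborel) \<partial>\<mu>)"
    by (intro nn_integral_cong) (auto simp: indicator_def norm_minus_commute)
  also have "\<dots> = (\<integral>\<^sup>+x. emeasure lborel ?C * indicator B x \<partial>\<mu>)"
  proof (rule nn_integral_cong)
    fix x :: 'a
    have "{y. - x + y \<in> ?C} = cball x 1"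
      by (auto simp: dist_norm norm_minus_commute)
    moreover have "(\<integral>\<^sup>+y. indicator (cball x 1) y * indicator B x \<partial>lborel)
        = emeasure lborel (cball x 1) * indicator B x"
      by (subst nn_integral_multc) (auto intro!: borel_measurable_indicator)
    ultimately show "(\<integral>\<^sup>+y. indicator {y. -x + y \<in> ?C} y * indicator B x \<partial>lborel)
        = emeasure lborel ?C * indicator B x"
      using emeasure_lborel_translation[of ?C "-x"] by simp
  qed
  also have "\<dots> = emeasure lborel ?C * emeasure \<mu> B"
    using B by (subst nn_integral_cmult) auto
  finally have *: "emeasure lborel ?C * emeasure lborel B = emeasure lborel ?C * emeasure \<mu> B"
    by (simp add: \<mu> vim_ball)
  have "emeasure lborel ?C \<noteq> 0"
  proof -
    have "emeasure lborel ?C = ennreal (unit_ball_vol (real DIM('a)))"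
      by (subst emeasure_cball) auto
    then show ?thesis by (simp add: unit_ball_vol_pos ennreal_eq_0_iff not_le)
  qed
  then have "emeasure lborel B = emeasure \<mu> B"
    using * by (metis ennreal_mult_cancel_left emeasure_bounded_finite bounded_cball less_irrefl infinity_ennreal_def)
  then show ?thesis using \<mu>[OF B] by simp
qed

text \<open>The parametrisation of the line in direction \<open>b\<close> whose coordinates in the directions other than \<open>b\<close> are given
by \<open>y\<close>.  Keeping the remaining coordinates as a function on \<open>Basis - {b}\<close> avoids a type of
dimension \<open>n - 1\<close>.\<close>
definition fibre_point :: "'a::euclidean_space \<Rightarrow> ('a \<Rightarrow> real) \<Rightarrow> real \<Rightarrow> 'a" where
  "fibre_point b y t = (\<Sum>j\<in>Basis - {b}. y j *\<^sub>R j) + t *\<^sub>R b"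

text \<open>Fubini in both orders: the volume is the integral of the lengths of the chords in direction \<open>b\<close>, which is
used for comparing volumes, and the integral of the volumes of the slices orthogonal to \<open>b\<close>, which is used for
computing one.\<close>
lemma
  fixes b :: "'a::euclidean_space"
  assumes b: "b \<in> Basis" and A: "A \<in> sets borel"
  defines "N \<equiv> Pi\<^sub>M (Basis - {b}) (\<lambda>_. lborel :: real measure)"
  shows emeasure_lborel_fibre_lengths:
      "emeasure lborel A = (\<integral>\<^sup>+y. emeasure lborel {t. fibre_point b y t \<in> A} \<partial>N)"
    and emeasure_lborel_slices:
      "emeasure lborel A = (\<integral>\<^sup>+t. emeasure N {y \<in> space N. fibre_point b y t \<in> A} \<partial>lborel)"
    and measurable_fibre_length: "(\<lambda>y. emeasure lborel {t. fibre_point b y t \<in> A}) \<in> borel_measurable N"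
proof -
  interpret product_sigma_finite "\<lambda>_::'a. lborel :: real measure" ..
  let ?g = "\<lambda>f. \<Sum>j\<in>Basis. f j *\<^sub>R j :: 'a"
  have ins: "insert b (Basis - {b}) = Basis" using b by auto
  have g: "?g (y(b := t)) = fibre_point b y t" for y t
    using b by (subst sum.remove[OF finite_Basis b]) (auto simp: fibre_point_def add.commute intro!: sum.cong)
  have [measurable]: "?g \<in> borel_measurable (Pi\<^sub>M Basis (\<lambda>_. lborel))" by measurable
  have "(\<lambda>p. fibre_point b (fst p) (snd p)) \<in> borel_measurable (N \<Otimes>\<^sub>M lborel)"
    unfolding fibre_point_def N_def by measurable
  then have [measurable]: "case_prod (fibre_point b) \<in> borel_measurable (N \<Otimes>\<^sub>M lborel)"
    by (simp add: split_beta')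
  have E: "emeasure lborel A = (\<integral>\<^sup>+f. indicator A (?g f) \<partial>Pi\<^sub>M Basis (\<lambda>_. lborel))"
    using A by (subst lborel_eq) (auto simp: nn_integral_distr simp flip: nn_integral_indicator)
  have m: "(\<lambda>f. indicator A (?g f)) \<in> borel_measurable (Pi\<^sub>M (insert b (Basis - {b})) (\<lambda>_. lborel))"
    using A unfolding ins by measurable
  have mA: "{t. fibre_point b y t \<in> A} \<in> sets lborel" if "y \<in> space N" for y
  proof -
    have "fibre_point b y \<in> borel_measurable borel" unfolding fibre_point_def by measurable
    then show ?thesis using A measurable_sets_borel[of "fibre_point b y" borel A] by (simp add: vimage_def)
  qed
  have mB: "{y \<in> space N. fibre_point b y t \<in> A} \<in> sets N" for t
    using A by measurable
  have len: "emeasure lborel {t. fibre_point b y t \<in> A} = (\<integral>\<^sup>+t. indicator A (fibre_point b y t) \<partial>lborel)"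
    if "y \<in> space N" for y
    using nn_integral_indicator[OF mA[OF that]] by (simp add: indicator_def)
  have slice: "emeasure N {y \<in> space N. fibre_point b y t \<in> A} = (\<integral>\<^sup>+y. indicator A (fibre_point b y t) \<partial>N)" for t
    by (subst nn_integral_indicator[OF mB, symmetric])
       (auto intro!: nn_integral_cong simp: indicator_def)
  show "emeasure lborel A = (\<integral>\<^sup>+y. emeasure lborel {t. fibre_point b y t \<in> A} \<partial>N)"
    unfolding E using product_nn_integral_insert[OF _ _ m, unfolded ins, folded N_def]
    by (simp add: N_def[symmetric] g len cong: nn_integral_cong del: fun_upd_apply)
  show "emeasure lborel A = (\<integral>\<^sup>+t. emeasure N {y \<in> space N. fibre_point b y t \<in> A} \<partial>lborel)"
    unfolding E using product_nn_integral_insert_rev[OF _ _ m, unfolded ins, folded N_def]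
    by (simp add: N_def[symmetric] g slice del: fun_upd_apply)
  have "(\<lambda>y. \<integral>\<^sup>+t. indicator A (fibre_point b y t) \<partial>lborel) \<in> borel_measurable N"
    using A by measurable
  then show "(\<lambda>y. emeasure lborel {t. fibre_point b y t \<in> A}) \<in> borel_measurable N"
    by (simp add: len cong: measurable_cong)
qed

section \<open>Averaging two bodies along a direction\<close>

text \<open>On each line in direction \<open>w\<close> this is the Minkowski mean of the chords of \<open>A\<close> and \<open>B\<close>.  If \<open>B\<close> is the reflection of
\<open>A\<close> in a hyperplane orthogonal to \<open>w\<close>, and \<open>A\<close> is convex, it is the Steiner symmetrization of \<open>A\<close>.\<close>
definition fibre_average :: "'a::euclidean_space \<Rightarrow> 'a set \<Rightarrow> 'a set \<Rightarrow> 'a set" where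
  "fibre_average w A B = {midpoint a b | a b. a \<in> A \<and> b \<in> B \<and> a - b \<in> span {w}}"

text \<open>As a linear image of a linear section of \<open>A \<times> B\<close>, the average inherits compactness and convexity.\<close>
lemma fibre_average_eq_image:
  "fibre_average w A B =
    (\<lambda>p. (1/2) *\<^sub>R (fst p + snd p)) ` (A \<times> B \<inter> (\<lambda>p. fst p - snd p) -` span {w})"
  unfolding fibre_average_def midpoint_def by (force simp: image_iff inverse_eq_divide)

lemma compact_fibre_average:
  assumes "compact A" "compact B"
  shows "compact (fibre_average w A B)"
  unfolding fibre_average_eq_image using assms
  by (intro compact_continuous_image compact_Int_closed compact_Times continuous_closed_vimage
      continuous_intros closed_span)

lemma convex_fibre_average:
  assumes "convex A" "convex B"
  shows "convex (fibre_average w A B)"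
  unfolding fibre_average_eq_image using assms
  by (intro convex_linear_image convex_Int convex_Times convex_linear_vimage
        linear_compose_scale_right linear_compose_add linear_compose_sub linear_fst linear_snd
        subspace_imp_convex[OF subspace_span])

text \<open>The one-dimensional case: the midpoints of two intervals fill an interval whose length is the mean of the
two lengths.  If one of the intervals is empty, there are no midpoints at all, and equality may fail.\<close>
lemma emeasure_midpoints_real_le:
  fixes S T X :: "real set"
  assumes S: "compact S" "convex S" and T: "compact T" "convex T"
    and X: "\<And>x. x \<in> X \<Longrightarrow> \<exists>s\<in>S. \<exists>t\<in>T. x = midpoint s t"
  shows "2 * emeasure lborel X \<le> emeasure lborel S + emeasure lborel T"
proof (cases "X = {}")
  case False
  obtain a b c d where I: "S = {a..b}" "T = {c..d}"
    using S T connected_compact_interval_1 convex_connected by metis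
  have ab: "a \<le> b" "c \<le> d" using False X I by fastforce+
  have "X \<subseteq> {midpoint a c..midpoint b d}"
    using X unfolding I midpoint_def by fastforce
  then have "emeasure lborel X \<le> emeasure lborel {midpoint a c..midpoint b d}"
    by (intro emeasure_mono) auto
  also have "\<dots> = ennreal ((b - a + (d - c)) / 2)"
    using ab by (simp add: midpoint_def field_simps)
  finally have "2 * emeasure lborel X \<le> 2 * ennreal ((b - a + (d - c)) / 2)"
    by (rule mult_left_mono) auto
  also have "\<dots> = ennreal (2 * ((b - a + (d - c)) / 2))"
    using ab by (subst ennreal_mult) auto
  also have "\<dots> = ennreal (b - a) + ennreal (d - c)"
    using ab by (subst ennreal_plus[symmetric]) (auto simp del: ennreal_plus)
  also have "\<dots> = emeasure lborel S + emeasure lborel T"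
    using ab by (simp add: I)
  finally show ?thesis .
qed auto

lemma fibre_point_affine: "fibre_point b y ((1 - u) * s + u * t) = (1 - u) *\<^sub>R fibre_point b y s + u *\<^sub>R fibre_point b y t"
  by (simp add: fibre_point_def algebra_simps)

text \<open>Integration of the one-dimensional inequality over all lines in direction \<open>b\<close>.\<close>
lemma emeasure_fibre_average_Basis_le:
  fixes A B :: "'a::euclidean_space set"
  assumes b: "b \<in> Basis" and A: "compact A" "convex A" and B: "compact B" "convex B"
  shows "2 * emeasure lborel (fibre_average b A B) \<le> emeasure lborel A + emeasure lborel B"
proof -
  let ?N = "Pi\<^sub>M (Basis - {b}) (\<lambda>_. lborel :: real measure)"
  let ?F = "\<lambda>S y. {t. fibre_point b y t \<in> S}"
  have borel: "A \<in> sets borel" "B \<in> sets borel" "fibre_average b A B \<in> sets borel"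
    using A B by (auto intro!: borel_closed compact_imp_closed compact_fibre_average)
  \<comment> \<open>the chords of a compact convex set are compact intervals\<close>
  have fibre_eq: "fibre_point b y = (\<lambda>t. (\<Sum>j\<in>Basis - {b}. y j *\<^sub>R j) + t *\<^sub>R b)" for y
    by (simp add: fibre_point_def fun_eq_iff)
  have F: "compact (?F S y)" "convex (?F S y)" if S: "compact S" "convex S" for S :: "'a set" and y
  proof -
    have "closed (fibre_point b y -` S)"
      using that by (intro continuous_closed_vimage compact_imp_closed)
        (auto simp: fibre_eq intro!: continuous_intros)
    moreover have "bounded (fibre_point b y -` S)"
    proof -
      obtain R where R: "\<And>x. x \<in> S \<Longrightarrow> norm x \<le> R"
        using compact_imp_bounded[OF S(1)] unfolding bounded_iff by blast
      have "norm t \<le> R + norm (\<Sum>j\<in>Basis - {b}. y j *\<^sub>R j)" if "fibre_point b y t \<in> S" for t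
      proof -
        have "norm (t *\<^sub>R b) \<le> norm (fibre_point b y t) + norm (\<Sum>j\<in>Basis - {b}. y j *\<^sub>R j)"
          using norm_triangle_ineq4[of "fibre_point b y t" "\<Sum>j\<in>Basis - {b}. y j *\<^sub>R j"] by (simp add: fibre_point_def)
        then show ?thesis using R[OF that] b by simp
      qed
      then show ?thesis unfolding bounded_iff by (auto simp: vimage_def)
    qed
    ultimately show "compact (?F S y)" by (simp add: compact_eq_bounded_closed vimage_def)
    show "convex (?F S y)"
      using convexD_alt[OF \<open>convex S\<close>] by (auto simp: convex_alt fibre_point_affine)
  qed
  have le: "2 * emeasure lborel (?F (fibre_average b A B) y)
      \<le> emeasure lborel (?F A y) + emeasure lborel (?F B y)" for y
  proof (rule emeasure_midpoints_real_le[OF F[OF A] F[OF B]])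
    fix t assume "t \<in> ?F (fibre_average b A B) y"
    then obtain p q s where pq: "p \<in> A" "q \<in> B" "p - q = s *\<^sub>R b" "fibre_point b y t = midpoint p q"
      by (auto simp: fibre_average_def span_singleton)
    have q: "q = p - s *\<^sub>R b" using pq(3) by (simp add: algebra_simps)
    have "fibre_point b y t = (1/2) *\<^sub>R (p + p) - (s/2) *\<^sub>R b"
      unfolding pq(4) q midpoint_def by (simp add: algebra_simps)
    then have "fibre_point b y t = p - (s/2) *\<^sub>R b" by (simp only: scaleR_half_double)
    \<comment> \<open>\<open>p\<close> and \<open>q\<close> lie symmetrically about their midpoint on the line itself\<close>
    then have p: "p = fibre_point b y (t + s/2)" by (simp add: fibre_point_def algebra_simps)
    have q: "q = fibre_point b y (t - s/2)" unfolding q p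
      by (simp add: fibre_point_def algebra_simps flip: scaleR_left_distrib)
    have "t = midpoint (t + s/2) (t - s/2)" by (simp add: midpoint_def)
    then show "\<exists>s\<in>?F A y. \<exists>s'\<in>?F B y. t = midpoint s s'"
      using pq p q by blast
  qed
  have "2 * emeasure lborel (fibre_average b A B)
      = (\<integral>\<^sup>+y. 2 * emeasure lborel (?F (fibre_average b A B) y) \<partial>?N)"
    using borel b by (subst nn_integral_cmult)
      (auto intro!: measurable_fibre_length simp: emeasure_lborel_fibre_lengths[OF b])
  also have "\<dots> \<le> (\<integral>\<^sup>+y. emeasure lborel (?F A y) + emeasure lborel (?F B y) \<partial>?N)"
    using le by (intro nn_integral_mono) auto
  also have "\<dots> = emeasure lborel A + emeasure lborel B"
    using borel b by (subst nn_integral_add)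
      (auto intro!: measurable_fibre_length simp: emeasure_lborel_fibre_lengths[OF b])
  finally show ?thesis .
qed

text \<open>An arbitrary direction is rotated into a coordinate direction; the average commutes with rotations.\<close>
lemma measure_fibre_average_le:
  fixes A B :: "(real ^ 'n) set"
  assumes A: "compact A" "convex A" and B: "compact B" "convex B"
  assumes w: "w \<noteq> 0"
  shows "2 * measure lebesgue (fibre_average w A B) \<le> measure lebesgue A + measure lebesgue B"
proof -
  obtain b :: "real ^ 'n" where b: "b \<in> Basis" using nonempty_Basis by blast
  obtain g :: "real ^ 'n \<Rightarrow> real ^ 'n" where g: "orthogonal_transformation g" "g (norm w *\<^sub>R b) = w"
    using orthogonal_transformation_exists[of "norm w *\<^sub>R b" w] b by auto
  have lin: "linear g" and bij: "bij g"
    using g by (auto simp: orthogonal_transformation_linear orthogonal_transformation_bij)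
  have lin': "linear (inv g)"
    using g(1) by (simp add: orthogonal_transformation_inv orthogonal_transformation_linear)
  have pre: "compact (g -` S)" "convex (g -` S)" if "compact S" "convex S" for S
    unfolding bij_vimage_eq_inv_image[OF bij] using lin' that
    by (auto intro!: compact_continuous_image convex_linear_image linear_continuous_on
          simp: linear_conv_bounded_linear)
  have gg: "x = y" if "g x = g y" for x y using bij that by (metis bij_inv_eq_iff)
  have sub: "g -` fibre_average w A B \<subseteq> fibre_average b (g -` A) (g -` B)"
  proof
    fix z assume "z \<in> g -` fibre_average w A B"
    then obtain p q s where pq: "p \<in> A" "q \<in> B" "p - q = s *\<^sub>R w" "g z = midpoint p q"
      by (auto simp: fibre_average_def span_singleton)
    obtain p' q' where p': "p = g p'" "q = g q'" using bij by (metis bij_pointE)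
    have "g z = g (midpoint p' q')"
      using pq p' lin by (simp add: midpoint_def linear_scale linear_add)
    moreover have "g (p' - q') = g ((s * norm w) *\<^sub>R b)"
      using pq p' lin g(2) by (metis linear_diff linear_scale scaleR_scaleR)
    then have "p' - q' \<in> span {b}" using gg by (auto simp: span_singleton)
    ultimately show "z \<in> fibre_average b (g -` A) (g -` B)"
      using pq p' gg by (auto simp: fibre_average_def)
  qed
  have vol: "emeasure lborel (g -` S) = emeasure lborel S"
     "emeasure lborel S = ennreal (measure lebesgue S)" if S: "compact S" for S
  proof -
    show "emeasure lborel (g -` S) = emeasure lborel S"
      using emeasure_orthogonal_vimage[OF g(1)] borel_compact[OF S] by blast
    show "emeasure lborel S = ennreal (measure lebesgue S)"
      using emeasure_bounded_finite[OF compact_imp_bounded[OF S]] borel_compact[OF S]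
      by (simp add: emeasure_eq_ennreal_measure less_top[symmetric])
  qed
  have "2 * emeasure lborel (fibre_average w A B) = 2 * emeasure lborel (g -` fibre_average w A B)"
    using A B by (subst vol(1)) (auto intro: compact_fibre_average)
  also have "\<dots> \<le> 2 * emeasure lborel (fibre_average b (g -` A) (g -` B))"
    using sub A B pre by (intro mult_left_mono emeasure_mono)
      (auto intro!: borel_compact compact_fibre_average)
  also have "\<dots> \<le> emeasure lborel (g -` A) + emeasure lborel (g -` B)"
    using A B b pre by (intro emeasure_fibre_average_Basis_le) auto
  also have "\<dots> = emeasure lborel A + emeasure lborel B"
    using A B by (simp add: vol(1))
  finally have "ennreal (2 * measure lebesgue (fibre_average w A B))
      \<le> ennreal (measure lebesgue A + measure lebesgue B)"
    using A B by (simp add: vol(2) compact_fibre_average ennreal_mult ennreal_plus)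
  then show ?thesis by (subst (asm) ennreal_le_iff) auto
qed

section \<open>Hulls of a ball and two points\<close>

text \<open>The hull with an arbitrary centre \<open>c\<close>; \<open>ball_two_points_hull r p q\<close> is the case \<open>c = midpoint p q\<close>.\<close>
abbreviation cap_body :: "real \<Rightarrow> 'a::euclidean_space \<Rightarrow> 'a \<Rightarrow> 'a \<Rightarrow> 'a set" where
  "cap_body r c p q \<equiv> convex hull (cball c r \<union> {p, q})"

lemma convex_body_cap_body:
  assumes "r > 0"
  shows "convex_body (cap_body r c p q)"
proof -
  have "ball c r \<subseteq> cap_body r c p q"
    using hull_subset[of "cball c r \<union> {p, q}" convex] ball_subset_cball[of c r] by blast
  then have "ball c r \<subseteq> interior (cap_body r c p q)"
    by (intro interior_maximal) auto
  then have "interior (cap_body r c p q) \<noteq> {}"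
    using assms centre_in_ball by blast
  then show ?thesis
    by (auto simp: convex_body_def intro!: compact_convex_hull compact_insert)
qed

lemma cap_body_subset:
  assumes "convex K" "cball c r \<subseteq> K" "p \<in> K" "q \<in> K"
  shows "cap_body r c p q \<subseteq> K"
  using assms by (intro hull_minimal) auto

text \<open>If the ball is not longer than the segment, everything lies in the ball with diameter \<open>[p, q]\<close>.\<close>
lemma diameter_ball_two_points_hull:
  fixes p q :: "'a::euclidean_space"
  assumes "2 * r \<le> dist p q"
  shows "diameter (ball_two_points_hull r p q) = dist p q"
proof (rule antisym)
  have "ball_two_points_hull r p q \<subseteq> cball (midpoint p q) (dist p q / 2)"
    unfolding ball_two_points_hull_def using assms
    by (intro hull_minimal) (auto simp: dist_midpoint)
  then have "diameter (ball_two_points_hull r p q) \<le> diameter (cball (midpoint p q) (dist p q / 2))"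
    by (intro diameter_subset) auto
  then show "diameter (ball_two_points_hull r p q) \<le> dist p q"
    by (simp add: not_less)
next
  have "bounded (ball_two_points_hull r p q)"
    unfolding ball_two_points_hull_def by (intro bounded_convex_hull) auto
  then show "dist p q \<le> diameter (ball_two_points_hull r p q)"
    by (rule diameter_bounded_bound) (auto simp: ball_two_points_hull_def hull_inc)
qed

text \<open>A hyperplane that touches the ball and does not separate it from \<open>p\<close> and \<open>q\<close> supports the hull.\<close>
lemma cap_body_below_hyperplane:
  assumes "norm \<theta> = 1" "\<theta> \<bullet> p \<le> \<theta> \<bullet> c + r" "\<theta> \<bullet> q \<le> \<theta> \<bullet> c + r" "x \<in> cap_body r c p q"
  shows "\<theta> \<bullet> x \<le> \<theta> \<bullet> c + r"
proof -
  have "\<theta> \<bullet> y \<le> \<theta> \<bullet> c + r" if "y \<in> cball c r" for y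
  proof -
    have "\<theta> \<bullet> (y - c) \<le> norm \<theta> * norm (y - c)" by (rule norm_cauchy_schwarz)
    also have "\<dots> \<le> r" using that assms(1) by (simp add: dist_norm norm_minus_commute)
    finally show ?thesis by (simp add: inner_diff_right)
  qed
  then have "cap_body r c p q \<subseteq> {x. \<theta> \<bullet> x \<le> \<theta> \<bullet> c + r}"
    using assms by (intro hull_minimal convex_halfspace_le) auto
  then show ?thesis using assms(4) by blast
qed

text \<open>In a direction orthogonal to \<open>q - p\<close>, which exists in dimension at least two, the hull is only as wide as its
ball, so no larger ball fits.\<close>
lemma inradius_ball_two_points_hull:
  fixes p q :: "'a::euclidean_space"
  assumes r: "0 \<le> r" and n: "2 \<le> DIM('a)"
  shows "inradius (ball_two_points_hull r p q) = r"
  unfolding inradius_def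
proof (rule cSup_eq_maximum)
  show "r \<in> {\<rho>. 0 \<le> \<rho> \<and> (\<exists>x. cball x \<rho> \<subseteq> ball_two_points_hull r p q)}"
    using r hull_subset[of "cball (midpoint p q) r \<union> {p, q}" convex]
    by (auto simp: ball_two_points_hull_def)
next
  let ?m = "midpoint p q"
  obtain y where y: "y \<noteq> 0" "orthogonal (q - p) y"
    using orthogonal_to_vector_exists[OF n] by metis
  define \<theta> where "\<theta> = y /\<^sub>R norm y"
  have \<theta>: "norm \<theta> = 1" "\<theta> \<bullet> p = \<theta> \<bullet> q"
    using y by (auto simp: \<theta>_def orthogonal_def inner_diff_left inner_diff_right inner_commute)
  have m: "\<theta> \<bullet> ?m = \<theta> \<bullet> p" "\<theta> \<bullet> ?m = \<theta> \<bullet> q"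
    using \<theta>(2) by (auto simp: midpoint_def inner_add_right)
  fix \<rho> assume "\<rho> \<in> {\<rho>. 0 \<le> \<rho> \<and> (\<exists>x. cball x \<rho> \<subseteq> ball_two_points_hull r p q)}"
  then obtain x where x: "0 \<le> \<rho>" "cball x \<rho> \<subseteq> cap_body r ?m p q"
    by (auto simp: ball_two_points_hull_def)
  have "x + \<rho> *\<^sub>R \<theta> \<in> cap_body r ?m p q"
    using \<theta> by (intro subsetD[OF x(2)]) (simp add: dist_norm x)
  then have "\<theta> \<bullet> (x + \<rho> *\<^sub>R \<theta>) \<le> \<theta> \<bullet> ?m + r"
    by (rule cap_body_below_hyperplane[rotated 3]) (use r m \<theta> in auto)
  moreover have "x - \<rho> *\<^sub>R \<theta> \<in> cap_body r ?m p q"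
    using \<theta> by (intro subsetD[OF x(2)]) (simp add: dist_norm x)
  then have "(- \<theta>) \<bullet> (x - \<rho> *\<^sub>R \<theta>) \<le> (- \<theta>) \<bullet> ?m + r"
    by (rule cap_body_below_hyperplane[rotated 3]) (use r m \<theta> in auto)
  moreover have "\<theta> \<bullet> \<theta> = 1" using \<theta> by (simp add: dot_square_norm)
  ultimately show "\<rho> \<le> r" by (simp add: inner_add_right inner_diff_right)
qed

lemma two_radius_le_diameter:
  fixes K :: "'a::euclidean_space set"
  assumes "bounded K" "cball x \<rho> \<subseteq> K" "0 \<le> \<rho>"
  shows "2 * \<rho> \<le> diameter K"
  using diameter_subset[OF assms(2,1)] assms(3) by simp

text \<open>The supremum in the inradius is attained: the pairs of centre and radius of the balls in \<open>K\<close> form a compact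
set.\<close>
lemma inball_exists:
  fixes K :: "'a::euclidean_space set"
  assumes K: "convex_body K"
  obtains c where "cball c (inradius K) \<subseteq> K" "0 < inradius K"
proof -
  have "compact K" using K by (simp add: convex_body_def)
  then have bdd: "bounded K" and "closed K"
    by (auto simp: compact_imp_bounded compact_imp_closed)
  define Q where "Q = (\<Inter>u\<in>cball 0 1. (\<lambda>z. fst z + snd z *\<^sub>R u) -` K) \<inter> {z. 0 \<le> snd z}"
  let ?R = "{\<rho>. 0 \<le> \<rho> \<and> (\<exists>x. cball x \<rho> \<subseteq> K)}"
  have ball: "(\<forall>u\<in>cball 0 1. x + \<rho> *\<^sub>R u \<in> K) \<longleftrightarrow> cball x \<rho> \<subseteq> K" if "0 \<le> \<rho>" for x \<rho>
  proof -
    have "cball x \<rho> = (\<lambda>u. x + \<rho> *\<^sub>R u) ` cball 0 1"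
    proof (intro equalityI subsetI)
      fix y assume y: "y \<in> cball x \<rho>"
      show "y \<in> (\<lambda>u. x + \<rho> *\<^sub>R u) ` cball 0 1"
      proof (cases "\<rho> = 0")
        case False
        then have "y = x + \<rho> *\<^sub>R ((1 / \<rho>) *\<^sub>R (y - x))" "(1 / \<rho>) *\<^sub>R (y - x) \<in> cball 0 1"
          using y that by (auto simp: dist_norm norm_minus_commute)
        then show ?thesis by blast
      qed (use y in \<open>auto intro!: image_eqI[of _ _ 0]\<close>)
    qed (use that in \<open>auto simp: dist_norm intro: mult_left_le\<close>)
    then show ?thesis by auto
  qed
  have Q_iff: "(x, \<rho>) \<in> Q \<longleftrightarrow> 0 \<le> \<rho> \<and> cball x \<rho> \<subseteq> K" for x \<rho>
    using ball[of \<rho> x] by (auto simp: Q_def)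
  \<comment> \<open>each condition \<open>x + \<rho> *\<^sub>R u \<in> K\<close> is closed in \<open>(x, \<rho>)\<close>\<close>
  have cl: "closed Q"
    unfolding Q_def
    by (intro closed_Int closed_INT ballI continuous_closed_vimage \<open>closed K\<close> closed_Collect_le
        continuous_intros)
  have "Q \<subseteq> K \<times> {0..diameter K}"
  proof
    fix z assume z: "z \<in> Q"
    then have c: "cball (fst z) (snd z) \<subseteq> K" "0 \<le> snd z" using Q_iff[of "fst z" "snd z"] by auto
    then have "fst z \<in> K" "2 * snd z \<le> diameter K"
      using two_radius_le_diameter[OF bdd] by auto
    then show "z \<in> K \<times> {0..diameter K}" using c by (cases z) auto
  qed
  then have "K \<times> {0..diameter K} \<inter> Q = Q" by (rule Int_absorb1)
  moreover have "compact (K \<times> {0..diameter K} \<inter> Q)"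
    using \<open>compact K\<close> cl by (intro compact_Int_closed compact_Times compact_Icc)
  ultimately have "compact (snd ` Q)" by (intro compact_continuous_image continuous_intros) simp
  moreover have "snd ` Q = ?R"
    using Q_iff by (auto simp: image_iff Bex_def split_paired_Ex) blast+
  ultimately have R: "compact ?R" by simp
  obtain z where "z \<in> interior K" using K by (auto simp: convex_body_def)
  then obtain e where e: "e > 0" "cball z e \<subseteq> K" using mem_interior_cball by blast
  then have ne: "e \<in> ?R" by auto
  have "inradius K \<in> ?R"
    unfolding inradius_def using R ne by (intro closed_contains_Sup compact_imp_closed)
      (auto intro: bounded_imp_bdd_above compact_imp_bounded)
  moreover have "e \<le> inradius K"
    unfolding inradius_def using R ne
    by (intro cSup_upper bounded_imp_bdd_above compact_imp_bounded)
  ultimately show ?thesis using that e by force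
qed

text \<open>A point of \<open>T\<close> outside the closed set \<open>S\<close> can be moved slightly towards an interior point, so that it becomes
interior to \<open>T\<close> and still avoids \<open>S\<close>.  Around it \<open>T\<close> has room of positive volume that \<open>S\<close> misses.\<close>
lemma measure_strict_mono_convex_body:
  fixes S T :: "'a::euclidean_space set"
  assumes S: "convex_body S" and T: "compact T" "convex T" and sub: "S \<subset> T"
  shows "measure lebesgue S < measure lebesgue T"
proof -
  obtain x where x: "x \<in> T" "x \<notin> S" using sub by blast
  obtain z where z: "z \<in> interior S" using S by (auto simp: convex_body_def)
  then have zT: "z \<in> interior T" using sub interior_mono by blast
  have "closed S" using S by (auto simp: convex_body_def compact_imp_closed)
  then obtain d where d: "d > 0" "ball x d \<inter> S = {}"
    using x by (metis Compl_iff open_Compl open_contains_ball disjoint_eq_subset_Compl)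
  have "x \<noteq> z" using x z interior_subset by blast
  define e where "e = min 1 (d / (2 * norm (x - z)))"
  have e: "0 < e" "e \<le> 1" "e * norm (x - z) < d"
    using d \<open>x \<noteq> z\<close> by (auto simp: e_def min_def field_simps)
  have "x - e *\<^sub>R (x - z) \<in> interior T"
    using mem_interior_convex_shrink[OF T(2) zT x(1) e(1,2)] .
  moreover have "x - e *\<^sub>R (x - z) \<in> ball x d" using e by (simp add: dist_norm)
  ultimately have ne: "interior T \<inter> ball x d \<noteq> {}" by blast
  let ?U = "interior T \<inter> ball x d"
  have open_U: "open ?U" by auto
  have U: "?U \<in> lmeasurable" by (intro lmeasurable_open) auto
  then have "measure lebesgue ?U > 0"
    using open_not_negligible[OF open_U ne] by (simp add: negligible_iff_measure zero_less_measure_iff)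
  moreover have "measure lebesgue S + measure lebesgue ?U = measure lebesgue (S \<union> ?U)"
  proof -
    have "?U - S = ?U" using d by blast
    then show ?thesis
      using S U measure_Un2[of S lebesgue ?U] by (simp add: convex_body_def lmeasurable_compact)
  qed
  moreover have "measure lebesgue (S \<union> ?U) \<le> measure lebesgue T"
    using S T U sub interior_subset[of T]
    by (intro measure_mono_fmeasurable) (auto simp: convex_body_def lmeasurable_compact fmeasurableD)
  ultimately show ?thesis by simp
qed

lemma orthogonal_transformation_dist:
  "orthogonal_transformation g \<Longrightarrow> dist (g x) (g y) = dist x y"
  by (metis dist_norm linear_diff orthogonal_transformation)

lemma midpoint_translation:
  fixes a b c :: "'a::real_vector"
  shows "midpoint (c + a) (c + b) = c + midpoint a b"
proof -
  have "(c + a) + (c + b) = (c + c) + (a + b)" by simp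
  then show ?thesis
    unfolding midpoint_def by (simp only: scaleR_right_distrib[of "inverse 2" "c + c" "a + b"]) simp
qed

lemma rigid_motion_cap_body:
  fixes g :: "'a::euclidean_space \<Rightarrow> 'a"
  assumes "orthogonal_transformation g"
  shows "(\<lambda>x. c + g x) ` cap_body r a p q = cap_body r (c + g a) (c + g p) (c + g q)"
proof -
  have "linear g" using assms by (rule orthogonal_transformation_linear)
  have "(\<lambda>x. c + g x) ` cap_body r a p q = (+) c ` (g ` (convex hull (cball a r \<union> {p, q})))"
    by (simp add: image_image)
  also have "\<dots> = convex hull ((+) c ` (g ` (cball a r \<union> {p, q})))"
    by (simp only: convex_hull_linear_image[OF \<open>linear g\<close>] convex_hull_translation)
  moreover have "g ` cball a r = cball (g a) r"
  proof (intro equalityI subsetI)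
    fix y assume y: "y \<in> cball (g a) r"
    obtain x where "y = g x" using orthogonal_transformation_surj[OF assms] by (metis surjD)
    then show "y \<in> g ` cball a r" using y orthogonal_transformation_dist[OF assms] by simp
  qed (use orthogonal_transformation_dist[OF assms] in auto)
  then have "(+) c ` (g ` (cball a r \<union> {p, q})) = cball (c + g a) r \<union> {c + g p, c + g q}"
    by (simp only: image_Un image_insert image_empty cball_translation)
  ultimately show ?thesis by (simp only:)
qed

lemma measure_rigid_motion:
  fixes S :: "'a::euclidean_space set" and g :: "'a \<Rightarrow> 'a"
  assumes g: "orthogonal_transformation g" and S: "compact S"
  shows "measure lebesgue ((\<lambda>x. c + g x) ` S) = measure lebesgue S"
proof -
  have bij: "bij g" using g by (rule orthogonal_transformation_bij)
  have "(\<lambda>x. c + g x) ` S = (+) c ` (g ` S)" by (simp add: image_image)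
  then have "measure lebesgue ((\<lambda>x. c + g x) ` S) = measure lebesgue (g ` S)"
    by (simp add: measure_translation)
  also have "\<dots> = measure lborel (g ` S)"
  proof (rule measure_completion)
    have "continuous_on S g"
      using orthogonal_transformation_linear[OF g] by (intro linear_continuous_on) (simp add: linear_conv_bounded_linear)
    then show "g ` S \<in> sets lborel"
      using S borel_compact[OF compact_continuous_image] by simp
  qed
  also have "g ` S = inv g -` S"
    using bij by (metis bij_imp_bij_inv bij_vimage_eq_inv_image inv_inv_eq)
  also have "measure lborel (inv g -` S) = measure lborel S"
    using emeasure_orthogonal_vimage[OF orthogonal_transformation_inv[OF g] borel_compact[OF S]]
    by (simp add: measure_def)
  also have "\<dots> = measure lebesgue S"
    using S by (intro measure_completion[symmetric]) (auto intro: borel_compact)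
  finally show ?thesis .
qed

text \<open>Any two segments of equal length are congruent, and the hull is determined by its segment and \<open>r\<close>.\<close>
lemma ball_two_points_hull_congruent:
  fixes p q p' q' :: "real ^ 'n"
  assumes "dist p q = dist p' q'"
  obtains f where "isometry f" "ball_two_points_hull r p' q' = f ` ball_two_points_hull r p q"
    "measure lebesgue (ball_two_points_hull r p' q') = measure lebesgue (ball_two_points_hull r p q)"
proof -
  have "norm (q - p) = norm (q' - p')" using assms by (simp add: dist_norm norm_minus_commute)
  then obtain g where g: "orthogonal_transformation g" "g (q - p) = q' - p'"
    using orthogonal_transformation_exists by blast
  have lin: "linear g" using g(1) by (rule orthogonal_transformation_linear)
  define c where "c = p' - g p"
  let ?f = "\<lambda>x. c + g x"
  have pq: "?f p = p'" "?f q = q'"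
    using g(2) linear_diff[OF lin] by (auto simp: c_def algebra_simps)
  have mid: "?f (midpoint p q) = midpoint p' q'"
  proof -
    have "g (midpoint p q) = midpoint (g p) (g q)"
      by (simp add: midpoint_def linear_add[OF lin] linear_scale[OF lin])
    then show ?thesis unfolding pq[symmetric] by (simp add: midpoint_translation)
  qed
  have im: "?f ` ball_two_points_hull r p q = ball_two_points_hull r p' q'"
    unfolding ball_two_points_hull_def rigid_motion_cap_body[OF g(1)] mid pq ..
  have "isometry ?f"
    unfolding isometry_def
  proof (intro conjI allI)
    show "surj ?f"
    proof (rule surjI)
      fix y show "?f (inv g (y - c)) = y"
        using orthogonal_transformation_surj[OF g(1)] by (simp add: surj_f_inv_f)
    qed
  qed (use g(1) in \<open>simp add: orthogonal_transformation_isometry\<close>)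
  moreover have "compact (ball_two_points_hull r p q)"
    unfolding ball_two_points_hull_def by (auto intro!: compact_convex_hull compact_insert)
  ultimately show ?thesis
    using that[of ?f] im measure_rigid_motion[OF g(1)] by metis
qed

section \<open>The centred hull has the smallest volume\<close>

text \<open>The point reflection in the midpoint exchanges \<open>p\<close> and \<open>q\<close> and turns the displacement \<open>w\<close> of the centre into
\<open>- w\<close>.\<close>
lemma measure_cap_body_reflect:
  fixes p q w :: "'a::euclidean_space"
  shows "measure lebesgue (cap_body r (midpoint p q - w) p q)
       = measure lebesgue (cap_body r (midpoint p q + w) p q)"
proof -
  have g: "orthogonal_transformation (uminus :: 'a \<Rightarrow> 'a)"
    by (simp add: orthogonal_transformation_neg orthogonal_transformation_id)
  have m: "p + q - midpoint p q = midpoint p q"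
    using scaleR_half_double[of "p + q"] by (simp add: midpoint_def scaleR_right_distrib algebra_simps)
  have "(\<lambda>x. (p + q) + - x) ` cap_body r (midpoint p q + w) p q = cap_body r (midpoint p q - w) p q"
  proof -
    have "p + q + - (midpoint p q + w) = midpoint p q - w"
      using arg_cong[OF m, of "\<lambda>x. x - w"] by (simp only: diff_diff_eq diff_conv_add_uminus[symmetric])
    moreover have "p + q + - p = q" "p + q + - q = p" by auto
    ultimately show ?thesis
      unfolding rigid_motion_cap_body[OF g] by (simp only: insert_commute)
  qed
  moreover have "compact (cap_body r (midpoint p q + w) p q)"
    by (auto intro!: compact_convex_hull compact_insert)
  ultimately show ?thesis
    using measure_rigid_motion[OF g] by metis
qed

text \<open>By convexity of the average only the ball and the two points need attention: a point \<open>x\<close> of the ball is the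
midpoint of \<open>x + w\<close> and \<open>x - w\<close>, and the points \<open>p\<close> and \<open>q\<close> belong to both bodies.\<close>
lemma ball_two_points_hull_subset_fibre_average:
  fixes p q w :: "'a::euclidean_space"
  defines "m \<equiv> midpoint p q"
  shows "ball_two_points_hull r p q \<subseteq> fibre_average w (cap_body r (m + w) p q) (cap_body r (m - w) p q)"
    (is "_ \<subseteq> fibre_average w ?A ?B")
  unfolding ball_two_points_hull_def
proof (rule hull_minimal)
  show "convex (fibre_average w ?A ?B)" by (intro convex_fibre_average convex_convex_hull)
  have A: "cball (m + w) r \<subseteq> ?A" "p \<in> ?A" "q \<in> ?A" and B: "cball (m - w) r \<subseteq> ?B" "p \<in> ?B" "q \<in> ?B"
    using hull_subset[of "cball (m + w) r \<union> {p, q}" convex]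
      hull_subset[of "cball (m - w) r \<union> {p, q}" convex] by auto
  have "x \<in> fibre_average w ?A ?B" if "x \<in> cball m r" for x
  proof -
    have "x + w \<in> ?A" "x - w \<in> ?B" using A(1) B(1) that by (auto simp: dist_norm algebra_simps)
    moreover have "x = midpoint (x + w) (x - w)"
      by (simp add: midpoint_def scaleR_right_distrib flip: scaleR_left_distrib)
    moreover have "(x + w) - (x - w) \<in> span {w}"
      by (simp add: span_add span_base)
    ultimately show ?thesis unfolding fibre_average_def by blast
  qed
  moreover have "x \<in> fibre_average w ?A ?B" if "x \<in> {p, q}" for x
  proof -
    have "x = midpoint x x" "x - x \<in> span {w}" by (auto simp: span_zero)
    then show ?thesis using A B that unfolding fibre_average_def by blast
  qed
  ultimately show "cball (midpoint p q) r \<union> {p, q} \<subseteq> fibre_average w ?A ?B"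
    unfolding m_def by blast
qed

text \<open>With \<open>d = q - m\<close> these are the unit normals of the hyperplanes through \<open>p\<close> or \<open>q\<close> that touch \<open>cball m r\<close>.
They make a fixed angle with the line of \<open>d\<close>, neither zero nor right.  In the plane of \<open>d\<close> and \<open>w\<close> there
are four of them, obtained from each other by changing signs of the two components, and a suitable
choice of signs gives a positive product with \<open>w\<close>.\<close>
lemma tangent_direction_exists:
  fixes w d :: "'a::euclidean_space"
  assumes n: "2 \<le> DIM('a)" and r: "0 < r" "r < norm d" and w: "w \<noteq> 0"
  obtains \<theta> where "norm \<theta> = 1" "\<bar>\<theta> \<bullet> d\<bar> = r" "0 < \<theta> \<bullet> w"
proof -
  have "norm d \<noteq> 0" using r by linarith
  define u where "u = d /\<^sub>R norm d"
  have u: "norm u = 1" "u \<bullet> u = 1" "d = norm d *\<^sub>R u"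
    using \<open>norm d \<noteq> 0\<close> by (auto simp: u_def dot_square_norm)
  define w' where "w' = w - (w \<bullet> u) *\<^sub>R u"
  have w': "u \<bullet> w' = 0" using u by (simp add: w'_def inner_diff_right inner_commute)
  \<comment> \<open>if \<open>w\<close> is parallel to \<open>d\<close>, any unit vector orthogonal to \<open>d\<close> serves as the second axis\<close>
  obtain v where v: "norm v = 1" "u \<bullet> v = 0" "w' = norm w' *\<^sub>R v"
  proof (cases "w' = 0")
    case True
    obtain y where "y \<noteq> 0" "orthogonal u y" using orthogonal_to_vector_exists[OF n] by metis
    then show ?thesis using True that[of "y /\<^sub>R norm y"] by (auto simp: orthogonal_def)
  next
    case False
    then show ?thesis using w' that[of "w' /\<^sub>R norm w'"] by auto
  qed
  have vv: "v \<bullet> v = 1" using v by (simp add: dot_square_norm)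
  define a where "a = r / norm d"
  define s where "s = sqrt (1 - a\<^sup>2)"
  define \<sigma> :: real where "\<sigma> = (if w \<bullet> u \<ge> 0 then 1 else -1)"
  have a: "0 < a" "a < 1"
    using r \<open>norm d \<noteq> 0\<close> by (simp_all add: a_def field_simps)
  then have "a\<^sup>2 < 1" by (simp add: power_less_one_iff abs_square_less_1)
  then have s: "0 < s" "s\<^sup>2 = 1 - a\<^sup>2" by (auto simp: s_def)
  define \<theta> where "\<theta> = (\<sigma> * a) *\<^sub>R u + s *\<^sub>R v"
  have \<sigma>: "\<sigma> * \<sigma> = 1" "\<sigma> * (w \<bullet> u) = \<bar>w \<bullet> u\<bar>" by (auto simp: \<sigma>_def)
  have "\<theta> \<bullet> \<theta> = (\<sigma> * \<sigma>) * a\<^sup>2 + s\<^sup>2"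
    using u v vv by (simp add: \<theta>_def inner_add_left inner_add_right inner_commute power2_eq_square algebra_simps)
  then have 1: "norm \<theta> = 1" using \<sigma> s by (simp add: norm_eq_1)
  have "\<theta> \<bullet> u = \<sigma> * a"
    using u(2) v(2) by (simp add: \<theta>_def inner_add_right inner_commute)
  then have "\<theta> \<bullet> d = norm d * (\<sigma> * a)" by (metis u(3) inner_scaleR_right)
  then have "\<theta> \<bullet> d = \<sigma> * r" using \<open>norm d \<noteq> 0\<close> by (simp add: a_def)
  then have 2: "\<bar>\<theta> \<bullet> d\<bar> = r" using r by (simp add: \<sigma>_def)
  have w_eq: "w = (w \<bullet> u) *\<^sub>R u + norm w' *\<^sub>R v" using v(3) by (simp add: w'_def)
  have "v \<bullet> w' = norm w'" using arg_cong[OF v(3), of "inner v"] vv by simp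
  moreover have "v \<bullet> w = v \<bullet> w'" using v(2) by (simp add: w'_def inner_diff_right inner_commute)
  ultimately have "\<theta> \<bullet> w = (\<sigma> * (w \<bullet> u)) * a + s * norm w'"
    by (simp add: \<theta>_def inner_add_left inner_commute[of u w])
  then have "\<theta> \<bullet> w = \<bar>w \<bullet> u\<bar> * a + s * norm w'" using \<sigma> by simp
  moreover have "\<bar>w \<bullet> u\<bar> > 0 \<or> norm w' > 0" using w w_eq by auto
  ultimately have 3: "0 < \<theta> \<bullet> w" using a s
    by (auto intro: add_pos_nonneg add_nonneg_pos)
  show ?thesis using that 1 2 3 by blast
qed

text \<open>The ray from \<open>e\<close> through the point \<open>c + r *\<^sub>R \<theta>\<close> of the sphere enters the ball there, because \<open>e\<close> lies strictly
beyond the tangent hyperplane at that point.  So the point lies strictly between \<open>e\<close> and an interior point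
of the ball.\<close>
lemma tangent_point_interior_cap_body:
  fixes c e \<theta> :: "'a::euclidean_space"
  assumes r: "0 < r" and \<theta>: "norm \<theta> = 1" and e: "\<theta> \<bullet> e > \<theta> \<bullet> c + r" and S: "convex S" "cball c r \<subseteq> S" "e \<in> S"
  shows "c + r *\<^sub>R \<theta> \<in> interior S"
proof -
  let ?x = "c + r *\<^sub>R \<theta>"
  define h where "h = \<theta> \<bullet> (e - ?x)"
  define N where "N = norm (?x - e)"
  define \<delta> where "\<delta> = r * h / (N\<^sup>2 + 1)"
  have \<theta>\<theta>: "\<theta> \<bullet> \<theta> = 1" using \<theta> by (simp add: dot_square_norm)
  have h: "h > 0" using e \<theta>\<theta> by (simp add: h_def inner_diff_right inner_add_right)
  have N1: "N\<^sup>2 + 1 > 0" by (simp add: add_nonneg_pos)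
  have \<delta>: "\<delta> > 0" using r h N1 by (simp add: \<delta>_def)
  have "\<delta> * N\<^sup>2 \<le> \<delta> * (N\<^sup>2 + 1)" using \<delta> by simp
  also have "\<dots> = r * h" using N1 by (simp add: \<delta>_def)
  also have "\<dots> < 2 * r * h" using r h by simp
  finally have small: "\<delta> * N\<^sup>2 < 2 * r * h" .
  \<comment> \<open>the choice of \<open>\<delta>\<close> keeps the quadratic term of \<open>norm (y - c)\<close> below the linear one\<close>
  define y where "y = ?x + \<delta> *\<^sub>R (?x - e)"
  have "(norm (y - c))\<^sup>2 = r\<^sup>2 - 2 * r * \<delta> * h + \<delta>\<^sup>2 * N\<^sup>2"
  proof -
    have yc: "y - c = r *\<^sub>R \<theta> + \<delta> *\<^sub>R (?x - e)" by (simp add: y_def)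
    have gen: "(norm (r *\<^sub>R \<theta> + \<delta> *\<^sub>R z))\<^sup>2 = r\<^sup>2 * (\<theta> \<bullet> \<theta>) + 2 * r * \<delta> * (\<theta> \<bullet> z) + \<delta>\<^sup>2 * (norm z)\<^sup>2" for z
      unfolding power2_norm_eq_inner
      by (simp add: inner_add_left inner_add_right inner_commute power2_eq_square algebra_simps)
    have "(norm (y - c))\<^sup>2 = r\<^sup>2 * (\<theta> \<bullet> \<theta>) + 2 * r * \<delta> * (\<theta> \<bullet> (?x - e)) + \<delta>\<^sup>2 * N\<^sup>2"
      unfolding N_def yc by (rule gen)
    moreover have "\<theta> \<bullet> (?x - e) = - h" by (simp add: h_def inner_diff_right)
    ultimately show ?thesis using \<theta>\<theta> by simp
  qed
  also have "\<dots> = r\<^sup>2 - \<delta> * (2 * r * h - \<delta> * N\<^sup>2)" by (simp add: power2_eq_square algebra_simps)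
  also have "\<dots> < r\<^sup>2" using small \<delta> by simp
  finally have "norm (y - c) < r" using r by (simp add: power2_less_imp_less)
  then have "y \<in> ball c r" by (simp add: dist_norm norm_minus_commute)
  moreover have "ball c r \<subseteq> interior S"
    using S(2) ball_subset_cball[of c r] by (intro interior_maximal) auto
  ultimately have y: "y \<in> interior S" by blast
  have "e - (1 / (1 + \<delta>)) *\<^sub>R (e - y) \<in> interior S"
    using \<delta> by (intro mem_interior_convex_shrink[OF S(1) y S(3)]) auto
  moreover have "e - y = (1 + \<delta>) *\<^sub>R (e - ?x)" by (simp add: y_def algebra_simps)
  then have "(1 / (1 + \<delta>)) *\<^sub>R (e - y) = e - ?x" using \<delta> by simp
  ultimately show ?thesis by (simp add: add.commute)
qed

text \<open>The heart of the matter.  The inequality is the inclusion of the centred hull in the average \<open>M\<close>.  It is strict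
because the average leaves the centred hull above the point of contact \<open>m + r *\<^sub>R \<theta>\<close>.\<close>
proposition measure_cap_body_ge:
  fixes p q w :: "real ^ 'n"
  assumes w: "w \<noteq> 0"
  shows "measure lebesgue (ball_two_points_hull r p q) \<le> measure lebesgue (cap_body r (midpoint p q + w) p q)"
    and "0 < r \<Longrightarrow> 2 * r < dist p q \<Longrightarrow> 2 \<le> CARD('n) \<Longrightarrow>
       measure lebesgue (ball_two_points_hull r p q) < measure lebesgue (cap_body r (midpoint p q + w) p q)"
proof -
  define m where "m = midpoint p q"
  let ?A = "cap_body r (m + w) p q" and ?B = "cap_body r (m - w) p q"
  let ?M = "fibre_average w ?A ?B"
  have AB: "compact ?A" "convex ?A" "compact ?B" "convex ?B"
    by (auto intro!: compact_convex_hull compact_insert)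
  have M: "compact ?M" "convex ?M" using AB by (auto intro: compact_fibre_average convex_fibre_average)
  have sub: "ball_two_points_hull r p q \<subseteq> ?M"
    unfolding m_def by (rule ball_two_points_hull_subset_fibre_average)
  have vol: "measure lebesgue ?M \<le> measure lebesgue ?A"
    using measure_fibre_average_le[OF AB w] measure_cap_body_reflect[of p q w r] by (simp add: m_def)
  have "compact (ball_two_points_hull r p q)"
    unfolding ball_two_points_hull_def by (auto intro!: compact_convex_hull compact_insert)
  then have "measure lebesgue (ball_two_points_hull r p q) \<le> measure lebesgue ?M"
    using M sub by (intro measure_mono_fmeasurable) (auto simp: lmeasurable_compact fmeasurableD)
  then show "measure lebesgue (ball_two_points_hull r p q) \<le> measure lebesgue (cap_body r (midpoint p q + w) p q)"
    using vol by (simp add: m_def)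
  assume r: "0 < r" and D: "2 * r < dist p q" and n: "2 \<le> CARD('n)"
  have "p + q - m = m"
    using scaleR_half_double[of "p + q"] by (simp add: m_def midpoint_def scaleR_right_distrib algebra_simps)
  then have qm: "q - m = - (p - m)" by (simp add: algebra_simps)
  have "r < norm (q - m)"
    using D by (simp add: m_def dist_midpoint dist_norm[symmetric] )
  then obtain \<theta> where \<theta>: "norm \<theta> = 1" "\<bar>\<theta> \<bullet> (q - m)\<bar> = r" "0 < \<theta> \<bullet> w"
    using tangent_direction_exists[of r "q - m" w] n r w by auto
  have le: "\<theta> \<bullet> p \<le> \<theta> \<bullet> m + r" "\<theta> \<bullet> q \<le> \<theta> \<bullet> m + r"
    and "\<theta> \<bullet> p = \<theta> \<bullet> m + r \<or> \<theta> \<bullet> q = \<theta> \<bullet> m + r"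
    using \<theta>(2) arg_cong[OF qm, of "\<lambda>x. \<theta> \<bullet> x"] by (auto simp: inner_diff_right)
  then obtain e where e: "e \<in> {p, q}" "\<theta> \<bullet> e = \<theta> \<bullet> m + r" by blast
  \<comment> \<open>in direction \<open>\<theta>\<close> the apex \<open>e\<close> is as high as \<open>m + r *\<^sub>R \<theta>\<close>, hence higher than this point moved by \<open>- w\<close>\<close>
  have "(m - w) + r *\<^sub>R \<theta> \<in> interior ?B"
    using e \<theta> r hull_subset[of "cball (m - w) r \<union> {p, q}" convex]
    by (intro tangent_point_interior_cap_body[of _ _ _ e]) (auto simp: inner_diff_right)
  then obtain \<eta> where \<eta>: "\<eta> > 0" "cball ((m - w) + r *\<^sub>R \<theta>) \<eta> \<subseteq> ?B"
    using mem_interior_cball by blast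
  define \<epsilon> where "\<epsilon> = \<eta> / norm w"
  have \<epsilon>: "\<epsilon> > 0" using \<eta> w by (simp add: \<epsilon>_def)
  \<comment> \<open>\<open>y\<close> and \<open>z\<close> would average to \<open>m + r *\<^sub>R \<theta>\<close> without the extra term \<open>\<epsilon> *\<^sub>R w\<close>, which pushes the midpoint over the hyperplane\<close>
  define y where "y = (m + w) + r *\<^sub>R \<theta>"
  define z where "z = ((m - w) + r *\<^sub>R \<theta>) + \<epsilon> *\<^sub>R w"
  have y: "y \<in> ?A" unfolding y_def
    using r \<theta> by (intro hull_inc) (simp add: dist_norm)
  have z: "z \<in> ?B" unfolding z_def
    using \<eta> w by (intro subsetD[OF \<eta>(2)]) (simp add: dist_norm \<epsilon>_def)
  have "y - z = (2 - \<epsilon>) *\<^sub>R w" by (simp add: y_def z_def algebra_simps scaleR_2)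
  then have "y - z \<in> span {w}" unfolding span_singleton by blast
  then have "midpoint y z \<in> ?M"
    using y z unfolding fibre_average_def by blast
  moreover have "midpoint y z \<notin> ball_two_points_hull r p q"
  proof
    assume "midpoint y z \<in> ball_two_points_hull r p q"
    then have "midpoint y z \<in> cap_body r m p q" by (simp only: ball_two_points_hull_def m_def)
    then have "\<theta> \<bullet> midpoint y z \<le> \<theta> \<bullet> m + r"
      by (rule cap_body_below_hyperplane[OF \<theta>(1) le])
    moreover have "\<theta> \<bullet> y = \<theta> \<bullet> m + \<theta> \<bullet> w + r" "\<theta> \<bullet> z = \<theta> \<bullet> m - \<theta> \<bullet> w + r + \<epsilon> * (\<theta> \<bullet> w)"
      using \<theta>(1) by (simp_all add: y_def z_def inner_add_right inner_diff_right dot_square_norm)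
    moreover have "\<theta> \<bullet> midpoint y z = (\<theta> \<bullet> y + \<theta> \<bullet> z) / 2"
      by (simp add: midpoint_def inner_add_right)
    ultimately have "\<epsilon> * (\<theta> \<bullet> w) \<le> 0" by argo
    then show False using \<epsilon> \<theta>(3) by (simp add: mult_le_0_iff)
  qed
  ultimately have "ball_two_points_hull r p q \<subset> ?M" using sub by blast
  then have "measure lebesgue (ball_two_points_hull r p q) < measure lebesgue ?M"
    using convex_body_cap_body[OF r] M
    by (intro measure_strict_mono_convex_body) (auto simp: ball_two_points_hull_def)
  then show "measure lebesgue (ball_two_points_hull r p q) < measure lebesgue (cap_body r (midpoint p q + w) p q)"
    using vol by (simp add: m_def)
qed

section \<open>Minimality and uniqueness among convex bodies\<close>
lemma convex_body_contains_cap_body: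
  fixes K :: "'a::euclidean_space set"
  assumes "convex_body K"
  obtains c p q where "cap_body (inradius K) c p q \<subseteq> K" "dist p q = diameter K"
    "0 < inradius K" "2 * inradius K \<le> diameter K"
proof -
  have K: "compact K" "convex K" "K \<noteq> {}" using assms interior_subset by (auto simp: convex_body_def)
  obtain c where c: "cball c (inradius K) \<subseteq> K" "0 < inradius K" using inball_exists[OF assms] .
  obtain p q where pq: "p \<in> K" "q \<in> K" "dist p q = diameter K"
    using diameter_compact_attained[OF K(1,3)] by blast
  show ?thesis
    using that[of c p q] cap_body_subset[OF K(2) c(1) pq(1,2)] c pq
      two_radius_le_diameter[OF compact_imp_bounded[OF K(1)] c(1)] by simp
qed

lemma measure_cap_body_ge_centred:
  fixes p q c :: "real ^ 'n"
  shows "measure lebesgue (ball_two_points_hull r p q) \<le> measure lebesgue (cap_body r c p q)"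
proof (cases "c = midpoint p q")
  case False
  then show ?thesis using measure_cap_body_ge(1)[of "c - midpoint p q" r p q] by simp
qed (simp add: ball_two_points_hull_def)

proposition measure_ball_two_points_hull_le:
  fixes K :: "(real ^ 'n) set" and p q :: "real ^ 'n"
  assumes K: "convex_body K" and D: "dist p q = diameter K"
  shows "measure lebesgue (ball_two_points_hull (inradius K) p q) \<le> measure lebesgue K"
proof -
  obtain c p' q' where sub: "cap_body (inradius K) c p' q' \<subseteq> K" and D': "dist p' q' = diameter K"
    and r: "0 < inradius K"
    using convex_body_contains_cap_body[OF K] by metis
  have "measure lebesgue (ball_two_points_hull (inradius K) p q)
      = measure lebesgue (ball_two_points_hull (inradius K) p' q')"
    using ball_two_points_hull_congruent[of p q p' q' "inradius K"] D D' by metis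
  also have "\<dots> \<le> measure lebesgue (cap_body (inradius K) c p' q')"
    by (rule measure_cap_body_ge_centred)
  also have "\<dots> \<le> measure lebesgue K"
    using K sub convex_body_cap_body[OF r, of c p' q']
    by (intro measure_mono_fmeasurable) (auto simp: convex_body_def lmeasurable_compact fmeasurableD)
  finally show ?thesis .
qed

text \<open>The volumes of the centred hull, of the hull contained in \<open>K\<close> and of \<open>K\<close> increase in this order, so they all agree.
Equality of the first two forces the inball to be centred, and equality of the last two forces \<open>K\<close> to be the hull.\<close>
proposition isometric_if_measure_le:
  fixes K :: "(real ^ 'n) set" and p q :: "real ^ 'n"
  assumes n: "2 \<le> CARD('n)"
    and K: "convex_body K" and D: "dist p q = diameter K" and rD: "2 * inradius K < diameter K"
    and vol: "measure lebesgue K \<le> measure lebesgue (ball_two_points_hull (inradius K) p q)"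
  obtains f where "isometry f" "K = f ` ball_two_points_hull (inradius K) p q"
proof -
  let ?r = "inradius K"
  obtain c p' q' where sub: "cap_body ?r c p' q' \<subseteq> K" and D': "dist p' q' = diameter K"
    and r: "0 < ?r"
    using convex_body_contains_cap_body[OF K] by metis
  obtain f where f: "isometry f" "ball_two_points_hull ?r p' q' = f ` ball_two_points_hull ?r p q"
    "measure lebesgue (ball_two_points_hull ?r p' q') = measure lebesgue (ball_two_points_hull ?r p q)"
    using ball_two_points_hull_congruent[of p q p' q' ?r] D D' by metis
  have "measure lebesgue (cap_body ?r c p' q') \<le> measure lebesgue K"
    using K sub convex_body_cap_body[OF r, of c p' q']
    by (intro measure_mono_fmeasurable) (auto simp: convex_body_def lmeasurable_compact fmeasurableD)
  then have le: "measure lebesgue (cap_body ?r c p' q') \<le> measure lebesgue (ball_two_points_hull ?r p' q')"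
    using vol f by simp
  have "c = midpoint p' q'"
  proof (rule ccontr)
    assume "c \<noteq> midpoint p' q'"
    then show False
      using measure_cap_body_ge(2)[of "c - midpoint p' q'" ?r p' q'] r rD D' n le by simp
  qed
  then have eq: "cap_body ?r c p' q' = ball_two_points_hull ?r p' q'"
    by (simp add: ball_two_points_hull_def)
  have "\<not> cap_body ?r c p' q' \<subset> K"
  proof
    assume "cap_body ?r c p' q' \<subset> K"
    then have "measure lebesgue (cap_body ?r c p' q') < measure lebesgue K"
      using K convex_body_cap_body[OF r]
      by (intro measure_strict_mono_convex_body) (auto simp: convex_body_def)
    then show False using vol f(3) unfolding eq by linarith
  qed
  then have "K = ball_two_points_hull ?r p' q'" using sub eq by blast
  then show ?thesis using that f by simp
qed

theorem ball_two_points_hull_minimizer: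
  fixes p q :: "real ^ 'n"
  assumes n: "2 \<le> CARD('n)" and r: "0 < r" "2 * r < dist p q"
  shows "volume_minimizer r (dist p q) (ball_two_points_hull r p q)"
    and "volume_minimizer r (dist p q) K \<Longrightarrow> \<exists>f. isometry f \<and> K = f ` ball_two_points_hull r p q"
proof -
  let ?H = "ball_two_points_hull r p q"
  have H: "convex_body ?H" "inradius ?H = r" "diameter ?H = dist p q"
    using r n convex_body_cap_body[OF r(1)] inradius_ball_two_points_hull[of r p q] diameter_ball_two_points_hull[of r p q]
    by (auto simp: ball_two_points_hull_def)
  show "volume_minimizer r (dist p q) ?H"
    unfolding volume_minimizer_def is_arg_min_def using H measure_ball_two_points_hull_le[of _ p q]
    by (auto simp: not_less)
  assume "volume_minimizer r (dist p q) K"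
  then have K: "convex_body K" "inradius K = r" "diameter K = dist p q"
    "measure lebesgue K \<le> measure lebesgue ?H"
    unfolding volume_minimizer_def is_arg_min_def using H by (auto simp: not_less)
  obtain f where "isometry f" "K = f ` ball_two_points_hull (inradius K) p q"
    using isometric_if_measure_le[OF n K(1), of p q] K r by auto
  then show "\<exists>f. isometry f \<and> K = f ` ?H" using K by auto
qed

section \<open>Volume of the centred hull\<close>
lemma sqrt_power_eq_powr:
  fixes x :: real
  assumes "0 \<le> x" "0 < m"
  shows "sqrt x ^ m = x powr (real m / 2)"
proof (cases "x = 0")
  case False
  then have "0 < sqrt x" using assms by simp
  then have "sqrt x ^ m = sqrt x powr real m" by (simp only: powr_realpow)
  also have "\<dots> = x powr (real m / 2)" using assms by (simp add: powr_half_sqrt[symmetric] powr_powr)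
  finally show ?thesis .
qed (use assms in simp)

text \<open>The function \<open>f\<close> is the radius of the slice of the centred hull at signed distance \<open>t\<close> from the centre.  Seen from
the centre, the tangent cone touches the sphere at the angle \<open>arccos (2 * r / D)\<close> from the axis, hence at height
\<open>t0\<close>, and \<open>c\<close> is the slope of the cone.  For \<open>D = 2 * r\<close> the cone is degenerate: \<open>t0 = D / 2\<close>, and \<open>c = 0\<close>
as a division by zero.\<close>
lemma integral_cap_profile:
  fixes r D :: real and n :: nat
  assumes r: "0 < r" and D: "2 * r \<le> D" and n: "1 \<le> n"
  defines "t0 \<equiv> 2 * r\<^sup>2 / D" and "c \<equiv> 2 * r / sqrt (D\<^sup>2 - 4 * r\<^sup>2)"
  defines "f \<equiv> \<lambda>t. if \<bar>t\<bar> \<le> t0 then sqrt (r\<^sup>2 - t\<^sup>2) else (D / 2 - \<bar>t\<bar>) * c"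
  shows "((\<lambda>t. f t ^ (n - 1)) has_integral
      2 * r ^ n * integral {arccos (2 * r / D)..pi / 2} (\<lambda>t. sin t ^ n)
      + r ^ (n - 1) / (real n * D ^ n) * (D\<^sup>2 - 4 * r\<^sup>2) powr ((real n + 1) / 2)) {- (D / 2)..D / 2}"
proof -
  obtain k where k: "n = Suc k" using n by (cases n) auto
  define \<alpha> where "\<alpha> = arccos (2 * r / D)"
  have D0: "D > 0" using r D by linarith
  have q: "0 < 2 * r / D" "2 * r / D \<le> 1" using r D D0 by (auto simp: field_simps)
  have cos\<alpha>: "cos \<alpha> = 2 * r / D" unfolding \<alpha>_def using q by (intro cos_arccos) auto
  have \<alpha>: "0 \<le> \<alpha>" "\<alpha> \<le> pi / 2" unfolding \<alpha>_def using q arccos_lbound[of "2 * r / D"] arccos_le_pi2[of "2 * r / D"] by auto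
  define S where "S = sqrt (D\<^sup>2 - 4 * r\<^sup>2)"
  have "(2 * r)\<^sup>2 \<le> D\<^sup>2" using r D by (intro power_mono) auto
  then have nn: "0 \<le> D\<^sup>2 - 4 * r\<^sup>2" by (simp add: power_mult_distrib)
  then have S: "0 \<le> S" "S\<^sup>2 = D\<^sup>2 - 4 * r\<^sup>2" by (auto simp: S_def)
  have t0: "t0 = r * cos \<alpha>" "0 < t0" using r D0 by (auto simp: t0_def cos\<alpha> power2_eq_square)
  have h: "D / 2 - t0 = S\<^sup>2 / (2 * D)"
  proof -
    have "2 * D * (D / 2 - t0) = S\<^sup>2"
      unfolding S(2) using D0 by (simp add: right_diff_distrib power2_eq_square t0_def)
    then show ?thesis using D0 by (simp add: eq_divide_eq mult.commute)
  qed
  then have t0h: "t0 \<le> D / 2" using D0 by (metis diff_ge_0_iff_ge divide_nonneg_pos mult_pos_pos zero_le_power2 zero_less_numeral)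
  have c: "c = 2 * r / S" by (simp add: c_def S_def)
  \<comment> \<open>up to height \<open>t0\<close> the substitution \<open>t = r * cos \<phi>\<close> produces the power of the sine\<close>
  let ?F = "\<lambda>t. sqrt (r\<^sup>2 - t\<^sup>2) ^ k"
  let ?J = "integral {\<alpha>..pi / 2} (\<lambda>t. sin t ^ n)"
  have sub: "((\<lambda>t. (- r * sin t) *\<^sub>R ?F (r * cos t)) has_integral
      (integral {r * cos \<alpha>..r * cos (pi / 2)} ?F - integral {r * cos (pi / 2)..r * cos \<alpha>} ?F)) {\<alpha>..pi / 2}"
  proof (rule has_integral_substitution_general[where s = "{}" and c = "-r" and d = r])
    show "(\<lambda>t. r * cos t) ` {\<alpha>..pi / 2} \<subseteq> {- r..r}"
    proof clarify
      fix t
      have "r * cos t \<le> r * 1" "r * (- 1) \<le> r * cos t"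
        using r by (intro mult_left_mono; simp)+
      then show "r * cos t \<in> {- r..r}" by simp
    qed
  qed (use \<alpha> in \<open>auto intro!: continuous_intros derivative_eq_intros\<close>)
  have pw: "(- r * sin t) *\<^sub>R ?F (r * cos t) = - (r ^ n * sin t ^ n)" if "t \<in> {\<alpha>..pi / 2}" for t
  proof -
    have "0 \<le> sin t" using that \<alpha> pi_gt_zero by (intro sin_ge_zero) auto
    moreover have "r\<^sup>2 - (r * cos t)\<^sup>2 = (r * sin t)\<^sup>2"
      by (simp add: power_mult_distrib sin_squared_eq algebra_simps)
    ultimately have "sqrt (r\<^sup>2 - (r * cos t)\<^sup>2) = r * sin t" using r by simp
    then show ?thesis by (simp add: k power_mult_distrib)
  qed
  have "integral {r * cos \<alpha>..r * cos (pi / 2)} ?F - integral {r * cos (pi / 2)..r * cos \<alpha>} ?F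
      = - integral {0..t0} ?F"
    using t0 by simp
  then have "((\<lambda>t. - (r ^ n * sin t ^ n)) has_integral (- integral {0..t0} ?F)) {\<alpha>..pi / 2}"
    using has_integral_eq[OF pw sub] by (simp only:)
  then have "integral {\<alpha>..pi / 2} (\<lambda>t. - (r ^ n * sin t ^ n)) = - integral {0..t0} ?F"
    by (rule integral_unique)
  then have J: "integral {0..t0} ?F = r ^ n * ?J" by simp
  have "?F integrable_on {0..t0}"
    by (intro integrable_continuous_real continuous_intros)
  then have "(?F has_integral r ^ n * ?J) {0..t0}" unfolding J[symmetric] by (rule integrable_integral)
  then have I1: "((\<lambda>t. f t ^ k) has_integral r ^ n * ?J) {0..t0}"
    by (rule has_integral_eq[rotated]) (auto simp: f_def)
  \<comment> \<open>beyond height \<open>t0\<close> the integrand is a power of a linear function, except perhaps at the single point \<open>t0\<close>, where \<open>f\<close> is defined by the sphere\<close>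
  have "((\<lambda>t. ((D / 2 - t) * c) ^ k) has_integral
      ((D / 2 - D / 2) ^ n * (- (c ^ k / n)) - (D / 2 - t0) ^ n * (- (c ^ k / n)))) {t0..D / 2}"
  proof (rule fundamental_theorem_of_calculus[OF t0h])
    fix t
    have "((\<lambda>t. D / 2 - t) has_real_derivative - 1) (at t within {t0..D / 2})"
      by (auto intro!: derivative_eq_intros)
    then have "((\<lambda>t. (D / 2 - t) ^ n * (- (c ^ k / n))) has_real_derivative
        (real n * (- 1 * (D / 2 - t) ^ (n - Suc 0))) * (- (c ^ k / n))) (at t within {t0..D / 2})"
      by (intro DERIV_cmult_right DERIV_power)
    moreover have "(real n * (- 1 * (D / 2 - t) ^ (n - Suc 0))) * (- (c ^ k / n)) = ((D / 2 - t) * c) ^ k"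
      by (simp add: k power_mult_distrib)
    ultimately show "((\<lambda>t. (D / 2 - t) ^ n * (- (c ^ k / n))) has_vector_derivative ((D / 2 - t) * c) ^ k)
        (at t within {t0..D / 2})"
      by (simp only: has_real_derivative_iff_has_vector_derivative)
  qed
  then have "((\<lambda>t. ((D / 2 - t) * c) ^ k) has_integral ((D / 2 - t0) ^ n * c ^ k / n)) {t0..D / 2}"
    by (simp add: k)
  then have I2: "((\<lambda>t. f t ^ k) has_integral ((D / 2 - t0) ^ n * c ^ k / n)) {t0..D / 2}"
    by (rule has_integral_spike_finite[of "{t0}", rotated 2]) (use t0 in \<open>auto simp: f_def\<close>)
  have I: "((\<lambda>t. f t ^ k) has_integral (r ^ n * ?J + (D / 2 - t0) ^ n * c ^ k / n)) {0..D / 2}" (is "(_ has_integral ?I) _")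
    using t0 t0h by (intro has_integral_combine[OF _ _ I1 I2]) auto
  have "f (- t) = f t" for t by (simp add: f_def)
  then have "((\<lambda>t. f t ^ k) has_integral ?I) {- (D / 2)..0}"
    using has_integral_reflect_real[where f = "\<lambda>t. f t ^ k" and a = "- (D / 2)" and b = 0] I by simp
  then have II: "((\<lambda>t. f t ^ k) has_integral (?I + ?I)) {- (D / 2)..D / 2}"
    using D0 by (intro has_integral_combine[OF _ _ _ I]) auto
  have cone: "2 * ((D / 2 - t0) ^ n * c ^ k) = r ^ k / D ^ n * S ^ (n + 1)"
  proof (cases "S = 0")
    case False
    have "(D / 2 - t0) ^ n * c ^ k = (D / 2 - t0) * ((D / 2 - t0) * c) ^ k"
      by (simp add: k power_mult_distrib)
    also have "(D / 2 - t0) * c = r * S / D"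
      unfolding h c using False D0 by (simp add: field_simps power2_eq_square)
    finally show ?thesis unfolding h using D0
      by (simp add: k power_mult_distrib power_divide power2_eq_square)
  qed (use n h in \<open>simp add: k\<close>)
  have powr: "S ^ (n + 1) = (D\<^sup>2 - 4 * r\<^sup>2) powr ((real n + 1) / 2)"
  proof -
    have "real (n + 1) = real n + 1" by simp
    moreover have "S ^ (n + 1) = (D\<^sup>2 - 4 * r\<^sup>2) powr (real (n + 1) / 2)"
      unfolding S_def by (rule sqrt_power_eq_powr[OF nn]) simp
    ultimately show ?thesis by (simp only:)
  qed
  have double: "(A + X / m) + (A + X / m) = 2 * A + (2 * X) / m" for A X m :: real
    by simp
  have "p / d * s / m = p / (m * d) * s" for p d s m :: real
    by simp
  then have "?I + ?I = 2 * (r ^ n * ?J) + r ^ k / (n * D ^ n) * S ^ (n + 1)"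
    unfolding double cone by (rule arg_cong)
  also have "2 * (r ^ n * ?J) = 2 * r ^ n * ?J"
    by (rule mult.assoc[symmetric])
  finally have eq: "?I + ?I = 2 * r ^ n * ?J + r ^ k / (n * D ^ n) * (D\<^sup>2 - 4 * r\<^sup>2) powr ((real n + 1) / 2)"
    unfolding powr .
  have "k = n - 1" by (simp add: k)
  show ?thesis using II[unfolded eq] unfolding \<alpha>_def \<open>k = n - 1\<close> .
qed

text \<open>The points within the profile: near the centre they are in the ball; further out each lies on
a segment from an apex to a point \<open>z\<close> of the disc bounded by the circle where the cone touches the ball.\<close>
lemma profile_point_in_cap_body:
  fixes b y :: "'a::euclidean_space"
  assumes r: "0 < r" and D: "2 * r \<le> D" and b: "norm b = 1" and y: "b \<bullet> y = 0" and t: "\<bar>t\<bar> \<le> D / 2"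
  assumes ny: "norm y \<le> (if \<bar>t\<bar> \<le> 2 * r\<^sup>2 / D then sqrt (r\<^sup>2 - t\<^sup>2)
    else (D / 2 - \<bar>t\<bar>) * (2 * r / sqrt (D\<^sup>2 - 4 * r\<^sup>2)))"
  shows "y + t *\<^sub>R b \<in> cap_body r 0 ((D / 2) *\<^sub>R b) (- (D / 2) *\<^sub>R b)"
proof -
  have D0: "D > 0" using r D by linarith
  have bb: "b \<bullet> b = 1" using b by (simp add: dot_square_norm)
  have norm2: "(norm (z + s *\<^sub>R b))\<^sup>2 = (norm z)\<^sup>2 + s\<^sup>2" if "b \<bullet> z = 0" for z s
    using that bb unfolding power2_norm_eq_inner
    by (simp add: inner_add_left inner_add_right inner_commute power2_eq_square)
  define t0 where "t0 = 2 * r\<^sup>2 / D"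
  define S where "S = sqrt (D\<^sup>2 - 4 * r\<^sup>2)"
  have "(2 * r)\<^sup>2 \<le> D\<^sup>2" using r D by (intro power_mono) auto
  then have nn: "0 \<le> D\<^sup>2 - 4 * r\<^sup>2" by (simp add: power_mult_distrib)
  then have S: "0 \<le> S" "S\<^sup>2 = D\<^sup>2 - 4 * r\<^sup>2" by (auto simp: S_def)
  have h: "D / 2 - t0 = S\<^sup>2 / (2 * D)"
  proof -
    have "2 * D * (D / 2 - t0) = S\<^sup>2"
      unfolding S(2) using D0 by (simp add: right_diff_distrib power2_eq_square t0_def)
    then show ?thesis using D0 by (simp add: eq_divide_eq mult.commute)
  qed
  show ?thesis
  proof (cases "\<bar>t\<bar> \<le> t0")
    case True
    have "t0 \<le> r" using D D0 r by (simp add: t0_def field_simps power2_eq_square)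
    then have "\<bar>t\<bar> \<le> \<bar>r\<bar>" using True r by linarith
    then have "t\<^sup>2 \<le> r\<^sup>2" by (rule abs_le_square_iff[THEN iffD1])
    then have "0 \<le> r\<^sup>2 - t\<^sup>2" by (rule diff_ge_0_iff_ge[THEN iffD2])
    moreover have "norm y \<le> sqrt (r\<^sup>2 - t\<^sup>2)" using ny True by (simp only: t0_def if_True)
    then have "(norm y)\<^sup>2 \<le> (sqrt (r\<^sup>2 - t\<^sup>2))\<^sup>2" by (rule power_mono) (rule norm_ge_zero)
    ultimately have "(norm y)\<^sup>2 \<le> r\<^sup>2 - t\<^sup>2" by (simp only: real_sqrt_pow2)
    then have "(norm (y + t *\<^sub>R b))\<^sup>2 \<le> r\<^sup>2" unfolding norm2[OF y] by linarith
    then have "norm (y + t *\<^sub>R b) \<le> r" by (rule power2_le_imp_le) (use r in simp)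
    then have "y + t *\<^sub>R b \<in> cball 0 r" by (simp only: mem_cball_0)
    then show ?thesis by (intro hull_inc UnI1)
  next
    case False
    define \<sigma> where "\<sigma> = sgn t"
    have \<sigma>: "\<sigma> = 1 \<or> \<sigma> = -1" "t = \<sigma> * \<bar>t\<bar>" using False r D0
      by (auto simp: \<sigma>_def sgn_if t0_def)
    have "t0 < D / 2" using False t by linarith
    then have "S \<noteq> 0" using h by auto
    then have S0: "S > 0" using S by simp
    define \<mu> where "\<mu> = (D / 2 - \<bar>t\<bar>) / (D / 2 - t0)"
    have \<mu>: "0 \<le> \<mu>" "\<mu> \<le> 1" using False t \<open>t0 < D / 2\<close> by (auto simp: \<mu>_def field_simps)
    have \<mu>h: "\<mu> * (D / 2 - t0) = D / 2 - \<bar>t\<bar>" using \<open>t0 < D / 2\<close> by (simp add: \<mu>_def)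
    have "norm y \<le> (D / 2 - \<bar>t\<bar>) * (2 * r / S)" using ny False by (simp add: t0_def S_def)
    also have "\<dots> = \<mu> * (r * S / D)"
      unfolding \<mu>h[symmetric] h using S0 D0 by (simp add: field_simps power2_eq_square)
    finally have ny: "norm y \<le> \<mu> * (r * S / D)" .
    have t_eq: "t = \<mu> * (\<sigma> * t0) + (1 - \<mu>) * (\<sigma> * (D / 2))"
    proof -
      have "\<bar>t\<bar> = D / 2 - \<mu> * (D / 2 - t0)" using \<mu>h by linarith
      moreover have "H - m * (H - s) = m * s + (1 - m) * H" for H m s :: real by (simp add: algebra_simps)
      ultimately have "\<bar>t\<bar> = \<mu> * t0 + (1 - \<mu>) * (D / 2)" by (simp only:)
      then have "\<sigma> * \<bar>t\<bar> = \<sigma> * (\<mu> * t0 + (1 - \<mu>) * (D / 2))" by simp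
      then show ?thesis using \<sigma>(2) by (simp add: algebra_simps)
    qed
    \<comment> \<open>projection from the apex to the height \<open>t0\<close>; at the apex itself \<open>\<mu> = 0\<close>, and \<open>1 / \<mu> = 0\<close> makes \<open>z\<close> the centre of the disc\<close>
    define z where "z = (1 / \<mu>) *\<^sub>R y + (\<sigma> * t0) *\<^sub>R b"
    have y_eq: "y = \<mu> *\<^sub>R (1 / \<mu>) *\<^sub>R y" using ny by (cases "\<mu> = 0") auto
    have "norm z \<le> r"
    proof -
      have "norm ((1 / \<mu>) *\<^sub>R y) \<le> r * S / D"
      proof (cases "\<mu> = 0")
        case False
        then show ?thesis using ny \<mu> by (simp add: field_simps)
      qed (use r S D0 in auto)
      then have "(norm ((1 / \<mu>) *\<^sub>R y))\<^sup>2 \<le> (r * S / D)\<^sup>2" by (intro power_mono) auto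
      moreover have "(\<sigma> * t0)\<^sup>2 = t0\<^sup>2" using \<sigma>(1) by auto
      moreover have "(r * S / D)\<^sup>2 + t0\<^sup>2 = r\<^sup>2"
        using D0 by (simp add: power_mult_distrib power_divide S(2) t0_def field_simps)
      ultimately have "(norm z)\<^sup>2 \<le> r\<^sup>2"
        using norm2[of "(1 / \<mu>) *\<^sub>R y" "\<sigma> * t0"] y by (simp add: z_def)
      then show ?thesis by (rule power2_le_imp_le) (use r in simp)
    qed
    then have "z \<in> cball 0 r" by (simp only: mem_cball_0)
    then have "z \<in> cap_body r 0 ((D / 2) *\<^sub>R b) (- (D / 2) *\<^sub>R b)" by (intro hull_inc UnI1)
    moreover have "(\<sigma> * (D / 2)) *\<^sub>R b = (D / 2) *\<^sub>R b \<or> (\<sigma> * (D / 2)) *\<^sub>R b = - (D / 2) *\<^sub>R b"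
      using \<sigma>(1) by (elim disjE) simp_all
    then have "(\<sigma> * (D / 2)) *\<^sub>R b \<in> cap_body r 0 ((D / 2) *\<^sub>R b) (- (D / 2) *\<^sub>R b)"
      by (intro hull_inc) blast
    ultimately have "\<mu> *\<^sub>R z + (1 - \<mu>) *\<^sub>R ((\<sigma> * (D / 2)) *\<^sub>R b) \<in> cap_body r 0 ((D / 2) *\<^sub>R b) (- (D / 2) *\<^sub>R b)"
      by (rule convexD[OF convex_convex_hull]) (use \<mu> in simp_all)
    moreover have "\<mu> *\<^sub>R z + (1 - \<mu>) *\<^sub>R ((\<sigma> * (D / 2)) *\<^sub>R b) = y + t *\<^sub>R b"
    proof -
      have "\<mu> *\<^sub>R z = y + (\<mu> * (\<sigma> * t0)) *\<^sub>R b"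
        unfolding z_def scaleR_right_distrib y_eq[symmetric] by simp
      then show ?thesis by (subst t_eq) (simp add: scaleR_left_distrib)
    qed
    ultimately show ?thesis by simp
  qed
qed

text \<open>With the axis in a coordinate direction, each slice contains a ball of dimension \<open>n - 1\<close> with the radius from
\<open>integral_cap_profile\<close>, and the volumes of these balls are integrated along the axis.\<close>
proposition measure_cap_body_formula_le:
  fixes b :: "'a::euclidean_space"
  assumes b: "b \<in> Basis" and n: "2 \<le> DIM('a)" and r: "0 < r" and D: "2 * r \<le> D"
  shows "2 * unit_ball_vol (real DIM('a) - 1) * r ^ DIM('a) *
        integral {arccos (2 * r / D)..pi / 2} (\<lambda>t. sin t ^ DIM('a))
      + unit_ball_vol (real DIM('a) - 1) * r ^ (DIM('a) - 1) / (real DIM('a) * D ^ DIM('a)) *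
        (D\<^sup>2 - 4 * r\<^sup>2) powr ((real DIM('a) + 1) / 2)
    \<le> measure lebesgue (cap_body r 0 ((D / 2) *\<^sub>R b) (- (D / 2) *\<^sub>R b))"
    (is "?V \<le> measure lebesgue ?K")
proof -
  let ?n = "DIM('a)" and ?N = "Pi\<^sub>M (Basis - {b}) (\<lambda>_. lborel :: real measure)"
  let ?\<omega> = "unit_ball_vol (real (?n - 1))"
  define f where "f = (\<lambda>t. if \<bar>t\<bar> \<le> 2 * r\<^sup>2 / D then sqrt (r\<^sup>2 - t\<^sup>2)
    else (D / 2 - \<bar>t\<bar>) * (2 * r / sqrt (D\<^sup>2 - 4 * r\<^sup>2)))"
  define K where "K = ?K"
  have D0: "D > 0" using r D by linarith
  have f0: "0 \<le> f t" if "\<bar>t\<bar> \<le> D / 2" for t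
  proof (cases "\<bar>t\<bar> \<le> 2 * r\<^sup>2 / D")
    case True
    have "2 * r\<^sup>2 / D \<le> r" using D D0 r by (simp add: field_simps power2_eq_square)
    then have "\<bar>t\<bar> \<le> \<bar>r\<bar>" using True r by linarith
    then have "t\<^sup>2 \<le> r\<^sup>2" by (rule abs_le_square_iff[THEN iffD1])
    then show ?thesis using True by (simp add: f_def)
  next
    case False
    have "(2 * r)\<^sup>2 \<le> D\<^sup>2" using r D by (intro power_mono) auto
    then show ?thesis using False that r by (simp add: f_def power_mult_distrib)
  qed
  have bn: "norm b = 1" "b \<bullet> b = 1" using b by auto
  have K: "compact K" unfolding K_def by (auto intro!: compact_convex_hull compact_insert)
  \<comment> \<open>slices of radius zero need no ball, since \<open>0 ^ (n - 1) = 0\<close> for \<open>n \<ge> 2\<close>\<close>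
  have slice: "ennreal (?\<omega> * f t ^ (?n - 1)) \<le> emeasure ?N {y \<in> space ?N. fibre_point b y t \<in> K}"
    if t: "t \<in> {- (D / 2)..D / 2}" for t
  proof (cases "f t = 0")
    case False
    then have ft: "f t > 0" using f0[of t] t by force
    have card: "card (Basis - {b}) = ?n - 1" using b by simp
    have "ennreal (?\<omega> * f t ^ (?n - 1))
        = emeasure ?N ({y. sqrt (\<Sum>j\<in>Basis - {b}. (y j)\<^sup>2) \<le> f t} \<inter> space ?N)"
      using emeasure_cball_aux[OF _ ft, of "Basis - {b}"] unfolding card by simp
    also have "\<dots> \<le> emeasure ?N {y \<in> space ?N. fibre_point b y t \<in> K}"
    proof (rule emeasure_mono)
      show "{y. sqrt (\<Sum>j\<in>Basis - {b}. (y j)\<^sup>2) \<le> f t} \<inter> space ?N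
        \<subseteq> {y \<in> space ?N. fibre_point b y t \<in> K}"
      proof clarify
        fix y assume y: "sqrt (\<Sum>j\<in>Basis - {b}. (y j)\<^sup>2) \<le> f t" "y \<in> space ?N"
        let ?y = "\<Sum>j\<in>Basis - {b}. y j *\<^sub>R j"
        have y_eq: "?y = (\<Sum>i\<in>Basis. (y(b := 0)) i *\<^sub>R i)"
          by (subst sum.remove[OF finite_Basis b]) simp
        have yi: "?y \<bullet> i = (y(b := 0)) i" if "i \<in> Basis" for i
          unfolding y_eq by (rule inner_sum_left_Basis[OF that])
        have "?y \<bullet> ?y = (\<Sum>i\<in>Basis. (?y \<bullet> i) * (?y \<bullet> i))"
          by (rule euclidean_inner)
        also have "\<dots> = (\<Sum>i\<in>Basis. ((y(b := 0)) i)\<^sup>2)"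
          by (intro sum.cong refl) (simp only: yi power2_eq_square)
        also have "\<dots> = (\<Sum>i\<in>Basis - {b}. (y i)\<^sup>2)"
          by (subst sum.remove[OF finite_Basis b]) simp
        finally have "norm ?y \<le> f t" using y(1) by (simp only: norm_eq_sqrt_inner)
        moreover have "b \<bullet> ?y = 0" using yi[OF b] by (simp only: inner_commute[of b] fun_upd_same)
        ultimately show "fibre_point b y t \<in> K"
          unfolding fibre_point_def K_def using t
          by (intro profile_point_in_cap_body r D bn) (auto simp: f_def)
      qed
      have "(\<lambda>y. fibre_point b y t) \<in> borel_measurable ?N" unfolding fibre_point_def by measurable
      then show "{y \<in> space ?N. fibre_point b y t \<in> K} \<in> sets ?N"
        using measurable_sets[of "\<lambda>y. fibre_point b y t" ?N borel K] borel_compact[OF K]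
        by (simp add: vimage_def Int_def conj_commute)
    qed
    finally show ?thesis .
  qed (use n in \<open>simp add: power_0_left\<close>)
  have "((\<lambda>t. ?\<omega> * f t ^ (?n - 1)) has_integral ?\<omega> * (2 * r ^ ?n * integral {arccos (2 * r / D)..pi / 2} (\<lambda>t. sin t ^ ?n)
      + r ^ (?n - 1) / (real ?n * D ^ ?n) * (D\<^sup>2 - 4 * r\<^sup>2) powr ((real ?n + 1) / 2))) {- (D / 2)..D / 2}"
    unfolding f_def using r D n by (intro has_integral_mult_right integral_cap_profile) auto
  moreover have "?\<omega> * (2 * r ^ ?n * integral {arccos (2 * r / D)..pi / 2} (\<lambda>t. sin t ^ ?n)
      + r ^ (?n - 1) / (real ?n * D ^ ?n) * (D\<^sup>2 - 4 * r\<^sup>2) powr ((real ?n + 1) / 2)) = ?V"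
  proof -
    have \<omega>: "?\<omega> = unit_ball_vol (real ?n - 1)" using n by (simp add: of_nat_diff)
    have "w * (2 * x * J + P / Q * T) = 2 * w * x * J + w * P / Q * T" for w x J P Q T :: real
      by (simp add: algebra_simps)
    then show ?thesis unfolding \<omega> .
  qed
  ultimately have "((\<lambda>t. ?\<omega> * f t ^ (?n - 1)) has_integral ?V) {- (D / 2)..D / 2}" by simp
  then have "ennreal ?V = (\<integral>\<^sup>+t. ennreal (?\<omega> * f t ^ (?n - 1)) * indicator {- (D / 2)..D / 2} t \<partial>lborel)"
    using f0 by (intro nn_integral_has_integral_lebesgue'[symmetric]) auto
  also have "\<dots> \<le> (\<integral>\<^sup>+t. emeasure ?N {y \<in> space ?N. fibre_point b y t \<in> K} \<partial>lborel)"
    using slice by (intro nn_integral_mono) (auto simp: indicator_def)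
  also have "\<dots> = emeasure lborel K"
    using emeasure_lborel_slices[OF b borel_compact[OF K]] by simp
  also have "\<dots> = ennreal (measure lebesgue K)"
    using emeasure_bounded_finite[OF compact_imp_bounded[OF K]] borel_compact[OF K]
    by (simp add: emeasure_eq_ennreal_measure less_top[symmetric])
  finally show ?thesis unfolding K_def by (rule ennreal_le_iff[OF measure_nonneg, THEN iffD1])
qed

text \<open>In the plane the integral of the squared sine is elementary, and \<open>sin\<close> and \<open>cos\<close> of the contact angle are
\<open>sqrt (D\<^sup>2 - 4 * r\<^sup>2) / D\<close> and \<open>2 * r / D\<close>; the terms of third order in \<open>r\<close> cancel.\<close>
lemma planar_cap_formula:
  fixes r D :: real
  assumes r: "0 < r" and D: "2 * r \<le> D"
  shows "2 * unit_ball_vol (real 2 - 1) * r ^ 2 * integral {arccos (2 * r / D)..pi / 2} (\<lambda>t. sin t ^ 2)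
      + unit_ball_vol (real 2 - 1) * r ^ (2 - 1) / (real 2 * D ^ 2) * (D\<^sup>2 - 4 * r\<^sup>2) powr ((real 2 + 1) / 2)
    = r * sqrt (D\<^sup>2 - 4 * r\<^sup>2) + r\<^sup>2 * (pi - 2 * arccos (2 * r / D))"
proof -
  define \<alpha> where "\<alpha> = arccos (2 * r / D)"
  have D0: "D > 0" using r D by linarith
  have q: "0 < 2 * r / D" "2 * r / D \<le> 1" using r D D0 by (auto simp: field_simps)
  have cos\<alpha>: "cos \<alpha> = 2 * r / D" unfolding \<alpha>_def using q by (intro cos_arccos) auto
  have \<alpha>: "\<alpha> \<le> pi / 2" unfolding \<alpha>_def using q arccos_le_pi2[of "2 * r / D"] by auto
  define S where "S = sqrt (D\<^sup>2 - 4 * r\<^sup>2)"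
  have "(2 * r)\<^sup>2 \<le> D\<^sup>2" using r D by (intro power_mono) auto
  then have nn: "0 \<le> D\<^sup>2 - 4 * r\<^sup>2" by (simp add: power_mult_distrib)
  then have S: "0 \<le> S" "S\<^sup>2 = D\<^sup>2 - 4 * r\<^sup>2" by (auto simp: S_def)
  have sin\<alpha>: "sin \<alpha> = S / D"
  proof -
    have "sin \<alpha> = sqrt (1 - (2 * r / D)\<^sup>2)" unfolding \<alpha>_def using q by (intro sin_arccos) auto
    also have "1 - (2 * r / D)\<^sup>2 = (S / D)\<^sup>2"
      using D0 by (simp add: power_divide S(2) field_simps power_mult_distrib)
    finally show ?thesis using S D0 by simp
  qed
  have "((\<lambda>t. sin t ^ 2) has_integral
      ((pi / 2 - sin (pi / 2) * cos (pi / 2)) / 2 - (\<alpha> - sin \<alpha> * cos \<alpha>) / 2)) {\<alpha>..pi / 2}"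
  proof (rule fundamental_theorem_of_calculus[OF \<alpha>])
    fix t
    have "((\<lambda>t. (t - sin t * cos t) / 2) has_real_derivative (1 - (cos t * cos t - sin t * sin t)) / 2) (at t within {\<alpha>..pi / 2})"
      by (auto intro!: derivative_eq_intros)
    moreover have "(1 - (cos t * cos t - sin t * sin t)) / 2 = sin t ^ 2"
      using sin_cos_squared_add[of t] by (simp add: power2_eq_square)
    ultimately show "((\<lambda>t. (t - sin t * cos t) / 2) has_vector_derivative sin t ^ 2) (at t within {\<alpha>..pi / 2})"
      by (simp add: has_real_derivative_iff_has_vector_derivative)
  qed
  then have I: "integral {\<alpha>..pi / 2} (\<lambda>t. sin t ^ 2) = (pi / 2 - \<alpha> + S / D * (2 * r / D)) / 2"
    by (subst integral_unique) (auto simp: sin\<alpha> cos\<alpha> field_simps)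
  have powr: "(D\<^sup>2 - 4 * r\<^sup>2) powr (3 / 2) = S ^ 3"
    unfolding S_def by (subst sqrt_power_eq_powr[OF nn]) simp_all
  have w: "unit_ball_vol 1 = 2" by (rule unit_ball_vol_1)
  have "4 * r\<^sup>2 * integral {\<alpha>..pi / 2} (\<lambda>t. sin t ^ 2) + r * S ^ 3 / D\<^sup>2
      = r\<^sup>2 * (pi - 2 * \<alpha>) + r * S * (4 * r\<^sup>2 + S\<^sup>2) / D\<^sup>2"
    unfolding I using D0 by (simp add: field_simps power2_eq_square power3_eq_cube)
  also have "\<dots> = r * S + r\<^sup>2 * (pi - 2 * \<alpha>)" unfolding S(2) using D0 by simp
  finally show ?thesis by (simp add: w powr \<alpha>_def[symmetric] S_def[symmetric])
qed

text \<open>All centred hulls with the same parameters are congruent, so the comparison may use the one whose axis is a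
coordinate axis and whose centre is the origin.\<close>
corollary convex_body_volume_lower_bound:
  fixes K :: "(real ^ 'n) set"
  assumes n: "2 \<le> CARD('n)" and K: "convex_body K"
  defines "r \<equiv> inradius K" and "D \<equiv> diameter K"
  shows "2 * unit_ball_vol (real CARD('n) - 1) * r ^ CARD('n) *
        integral {arccos (2 * r / D)..pi / 2} (\<lambda>t. sin t ^ CARD('n))
      + unit_ball_vol (real CARD('n) - 1) * r ^ (CARD('n) - 1) / (real CARD('n) * D ^ CARD('n)) *
        (D\<^sup>2 - 4 * r\<^sup>2) powr ((real CARD('n) + 1) / 2)
    \<le> measure lebesgue K"
proof -
  have r: "0 < r" "2 * r \<le> D"
    using convex_body_contains_cap_body[OF K] unfolding r_def D_def by metis+
  obtain b :: "real ^ 'n" where b: "b \<in> Basis" using nonempty_Basis by blast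
  define p q where "p = (D / 2) *\<^sub>R b" and "q = - (D / 2) *\<^sub>R b"
  have "p - q = D *\<^sub>R b" by (simp add: p_def q_def flip: scaleR_left_distrib)
  then have dist: "dist p q = D" using b r by (simp add: dist_norm)
  have mid: "midpoint p q = 0" by (simp add: p_def q_def midpoint_def)
  have "measure lebesgue (cap_body r 0 p q) = measure lebesgue (ball_two_points_hull r p q)"
    by (simp only: ball_two_points_hull_def mid)
  also have "\<dots> \<le> measure lebesgue K"
    using measure_ball_two_points_hull_le[OF K, of p q] dist by (simp only: r_def D_def)
  finally show ?thesis
    using measure_cap_body_formula_le[OF b _ r] n unfolding p_def q_def by simp
qed

theorem theorem1:
  assumes "CARD('n::finite) \<ge> 2"
  shows
    "(\<forall>r D. 0 < r \<and> 2 * r < D \<longrightarrow>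
        (\<forall>p q :: real ^ 'n. dist p q = D \<longrightarrow>
           volume_minimizer r D (ball_two_points_hull r p q) \<and>
           (\<forall>K. volume_minimizer r D K \<longrightarrow>
              (\<exists>f. isometry f \<and> K = f ` ball_two_points_hull r p q))))
     \<and>
     (\<forall>(K :: (real ^ 'n) set) V D r.
        convex_body K \<and> V = measure lebesgue K \<and> D = diameter K \<and> r = inradius K \<longrightarrow>
        V \<ge> 2 * unit_ball_vol (real CARD('n) - 1) * r ^ CARD('n) *
               integral {arccos (2 * r / D)..pi / 2} (\<lambda>t. sin t ^ CARD('n))
             + unit_ball_vol (real CARD('n) - 1) * r ^ (CARD('n) - 1) / (real CARD('n) * D ^ CARD('n)) *
               (D\<^sup>2 - 4 * r\<^sup>2) powr ((real CARD('n) + 1) / 2))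
     \<and>
     (\<forall>(K :: (real ^ 2) set) A D r.
        convex_body K \<and> A = measure lebesgue K \<and> D = diameter K \<and> r = inradius K \<longrightarrow>
        A \<ge> r * sqrt (D\<^sup>2 - 4 * r\<^sup>2) + r\<^sup>2 * (pi - 2 * arccos (2 * r / D)))"
proof (intro conjI allI impI)
  fix r D :: real and p q :: "real ^ 'n"
  assume r: "0 < r \<and> 2 * r < D" and pq: "dist p q = D"
  show "volume_minimizer r D (ball_two_points_hull r p q)"
    using ball_two_points_hull_minimizer(1)[OF assms] r pq by blast
next
  fix r D :: real and p q :: "real ^ 'n" and K :: "(real ^ 'n) set"
  assume r: "0 < r \<and> 2 * r < D" and pq: "dist p q = D" and K: "volume_minimizer r D K"
  show "\<exists>f. isometry f \<and> K = f ` ball_two_points_hull r p q"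
    using ball_two_points_hull_minimizer(2)[OF assms] r pq K by blast
next
  fix K :: "(real ^ 'n) set" and V D r
  assume "convex_body K \<and> V = measure lebesgue K \<and> D = diameter K \<and> r = inradius K"
  then show "V \<ge> 2 * unit_ball_vol (real CARD('n) - 1) * r ^ CARD('n) *
               integral {arccos (2 * r / D)..pi / 2} (\<lambda>t. sin t ^ CARD('n))
             + unit_ball_vol (real CARD('n) - 1) * r ^ (CARD('n) - 1) / (real CARD('n) * D ^ CARD('n)) *
               (D\<^sup>2 - 4 * r\<^sup>2) powr ((real CARD('n) + 1) / 2)"
    using convex_body_volume_lower_bound[OF assms] by blast
next
  fix K :: "(real ^ 2) set" and A D r
  assume K: "convex_body K \<and> A = measure lebesgue K \<and> D = diameter K \<and> r = inradius K"
  have "0 < r" "2 * r \<le> D"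
    using convex_body_contains_cap_body[of K] K by metis+
  note formula = planar_cap_formula[OF this]
  have card: "CARD(2) = 2" by simp
  show "A \<ge> r * sqrt (D\<^sup>2 - 4 * r\<^sup>2) + r\<^sup>2 * (pi - 2 * arccos (2 * r / D))"
    using convex_body_volume_lower_bound[of K, unfolded card] K formula by simp
qed

end
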